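(* Let $G(\mathbb Z)=\mathbb Z\times H_3(\mathbb Z)$ and let $\rho_1,\rho_2$ be the left-invariant word metrics on $G(\mathbb Z)$ associated respectively to the finite generating sets $$S_1=\{(1;0,0,1)^{\pm1},(1;0,0,-1)^{\pm1},(0;1,0,0)^{\pm1},(0;0,1,0)^{\pm1}\},$$ $$S_2=\{(1;0,0,0)^{\pm1},(0;1,0,0)^{\pm1},(0;0,1,0)^{\pm1}\}.$$ Then $(G(\mathbb Z),\rho_1)$ and $(G(\mathbb Z),\rho_2)$ are quasi-isometric and have isometric asymptotic cones, but there is no $C>0$ such that $(G(\mathbb Z),\rho_1)$ is $(1,C)$-quasi-isometric to $(G(\mathbb Z),\rho_2)$.
   Context: $H_3(\mathbb R)$ is the 3-dimensional Heisenberg group; its Lie algebra has a basis $X,Y,Z$ with $[X,Y]=Z$, $Z$ central. An element of $\mathbb R\times H_3(\mathbb R)$ is written $(v;x,y,z)$, meaning $(v,\exp(xX+yY+zZ))$; thus $(v;x,y,z)(v';x',y',z')=(v+v';x+x',y+y',z+z'+\frac12(xy'-yx'))$. $H_3(\mathbb Z)$ is the subgroup of $H_3(\mathbb R)$ generated by $\exp X$ and $\exp Y$. The word metric of a finite symmetric generating set $S$ is the left-invariant metric for which $\rho(\mathrm{id},\gamma)$ is the least length of a word in $S$ representing $\gamma$. The asymptotic cone of $(G(\mathbb Z),\rho_i)$ is the pointed Gromov-Hausdorff limit of $(G(\mathbb Z),\frac1n\rho_i,\mathrm{id})$ as $n\to\infty$. A map $\phi:X\to Y$ between metric spaces is a $(1,C)$-quasi-isometry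 if $d_X(a,b)-C\le d_Y(\phi(a),\phi(b))\le d_X(a,b)+C$ for all $a,b\in X$ and every $y\in Y$ is at distance at most $C$ from some element of $\phi(X)$; $X$ is $(1,C)$-quasi-isometric to $Y$ if such a map exists. *)

theory Defs
  imports "HOL-Analysis.Analysis" "HOL-Algebra.Elementary_Groups"
begin

definition symmetrize :: "('a, 'b) monoid_scheme \<Rightarrow> 'a set \<Rightarrow> 'a set" where
  "symmetrize G A = A \<union> m_inv G ` A"

definition word_value :: "('a, 'b) monoid_scheme \<Rightarrow> 'a list \<Rightarrow> 'a" where
  "word_value G ws = foldr (mult G) ws (one G)"

definition word_length :: "('a, 'b) monoid_scheme \<Rightarrow> 'a set \<Rightarrow> 'a \<Rightarrow> nat" where
  "word_length G S g = (LEAST n. \<exists>ws. set ws \<subseteq> S \<and> length ws = n \<and> word_value G ws = g)"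

text \<open>The value \<open>0\<close> outside the carrier makes \<open>word_metric G S\<close> an instance of the locale
  \<open>Metric_space\<close>, which demands symmetry on the whole type.\<close>

definition word_metric :: "('a, 'b) monoid_scheme \<Rightarrow> 'a set \<Rightarrow> 'a \<Rightarrow> 'a \<Rightarrow> real" where
  "word_metric G S g h =
     (if g \<in> carrier G \<and> h \<in> carrier G then real (word_length G S (inv\<^bsub>G\<^esub> g \<otimes>\<^bsub>G\<^esub> h)) else 0)"

definition isometric :: "'a set \<Rightarrow> ('a \<Rightarrow> 'a \<Rightarrow> real) \<Rightarrow> 'b set \<Rightarrow> ('b \<Rightarrow> 'b \<Rightarrow> real) \<Rightarrow> bool" where
  "isometric X dX Y dY \<longleftrightarrow>
     (\<exists>f. bij_betw f X Y \<and> (\<forall>a\<in>X. \<forall>b\<in>X. dY (f a) (f b) = dX a b))"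

definition quasi_isometry ::
  "real \<Rightarrow> real \<Rightarrow> 'a set \<Rightarrow> ('a \<Rightarrow> 'a \<Rightarrow> real) \<Rightarrow> 'b set \<Rightarrow> ('b \<Rightarrow> 'b \<Rightarrow> real) \<Rightarrow> ('a \<Rightarrow> 'b) \<Rightarrow> bool" where
  "quasi_isometry L C X dX Y dY f \<longleftrightarrow>
     f \<in> X \<rightarrow> Y \<and>
     (\<forall>a\<in>X. \<forall>b\<in>X. dX a b / L - C \<le> dY (f a) (f b) \<and> dY (f a) (f b) \<le> L * dX a b + C) \<and>
     (\<forall>y\<in>Y. \<exists>a\<in>X. dY y (f a) \<le> C)"

definition quasi_isometric_with ::
  "real \<Rightarrow> real \<Rightarrow> 'a set \<Rightarrow> ('a \<Rightarrow> 'a \<Rightarrow> real) \<Rightarrow> 'b set \<Rightarrow> ('b \<Rightarrow> 'b \<Rightarrow> real) \<Rightarrow> bool" where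
  "quasi_isometric_with L C X dX Y dY \<longleftrightarrow> (\<exists>f. quasi_isometry L C X dX Y dY f)"

definition quasi_isometric :: "'a set \<Rightarrow> ('a \<Rightarrow> 'a \<Rightarrow> real) \<Rightarrow> 'b set \<Rightarrow> ('b \<Rightarrow> 'b \<Rightarrow> real) \<Rightarrow> bool" where
  "quasi_isometric X dX Y dY \<longleftrightarrow> (\<exists>L C. L \<ge> 1 \<and> C \<ge> 0 \<and> quasi_isometric_with L C X dX Y dY)"

text \<open>Pointed Gromov--Hausdorff convergence in the sense of Burago--Burago--Ivanov, Definition 8.1.1.\<close>

definition pointed_GH_converges ::
  "(nat \<Rightarrow> 'a set) \<Rightarrow> (nat \<Rightarrow> 'a \<Rightarrow> 'a \<Rightarrow> real) \<Rightarrow> (nat \<Rightarrow> 'a) \<Rightarrow>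
     'b set \<Rightarrow> ('b \<Rightarrow> 'b \<Rightarrow> real) \<Rightarrow> 'b \<Rightarrow> bool" where
  "pointed_GH_converges X d p Y dY q \<longleftrightarrow>
     (\<forall>r>0. \<forall>\<epsilon>>0. \<forall>\<^sub>F n in sequentially.
        \<exists>f. f \<in> {a \<in> X n. d n (p n) a < r} \<rightarrow> Y \<and>
            f (p n) = q \<and>
            (\<forall>a\<in>{a \<in> X n. d n (p n) a < r}. \<forall>b\<in>{a \<in> X n. d n (p n) a < r}.
               \<bar>dY (f a) (f b) - d n a b\<bar> < \<epsilon>) \<and>
            (\<forall>y\<in>{y \<in> Y. dY q y < r - \<epsilon>}. \<exists>a\<in>{a \<in> X n. d n (p n) a < r}. dY y (f a) < \<epsilon>))"

text \<open>The limit is required to be proper (closed balls are compact); among proper spaces a pointed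
  Gromov--Hausdorff limit is unique up to pointed isometry, which justifies speaking of
  \<^emph>\<open>the\<close> asymptotic cone. The term with \<open>n = 0\<close> is irrelevant.\<close>

definition proper_metric_space :: "'a set \<Rightarrow> ('a \<Rightarrow> 'a \<Rightarrow> real) \<Rightarrow> bool" where
  "proper_metric_space X d \<longleftrightarrow>
     Metric_space X d \<and>
     (\<forall>x\<in>X. \<forall>r. compactin (Metric_space.mtopology X d) (Metric_space.mcball X d x r))"

definition asymptotic_cone ::
  "'a set \<Rightarrow> ('a \<Rightarrow> 'a \<Rightarrow> real) \<Rightarrow> 'a \<Rightarrow> 'b set \<Rightarrow> ('b \<Rightarrow> 'b \<Rightarrow> real) \<Rightarrow> 'b \<Rightarrow> bool" where
  "asymptotic_cone X d p Y dY q \<longleftrightarrow>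
     proper_metric_space Y dY \<and> q \<in> Y \<and>
     pointed_GH_converges (\<lambda>n. X) (\<lambda>n a b. d a b / real n) (\<lambda>n. p) Y dY q"

text \<open>Exponential coordinates: \<open>(x, y, z)\<close> stands for \<open>exp (x X + y Y + z Z)\<close>, where \<open>[X, Y] = Z\<close>;
  the multiplication is the Baker--Campbell--Hausdorff formula. In these coordinates the
  third coordinate of an element of \<open>H\<^sub>3(\<int>)\<close> may be a half-integer.\<close>

definition heisenberg_real :: "(real \<times> real \<times> real) monoid" where
  "heisenberg_real =
     \<lparr>carrier = UNIV,
      monoid.mult = (\<lambda>(x, y, z) (x', y', z'). (x + x', y + y', z + z' + (x * y' - y * x') / 2)),
      one = (0, 0, 0)\<rparr>"

definition heisenberg_int :: "(real \<times> real \<times> real) monoid" where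
  "heisenberg_int =
     heisenberg_real\<lparr>carrier := generate heisenberg_real {(1, 0, 0), (0, 1, 0)}\<rparr>"

definition GZ :: "(int \<times> real \<times> real \<times> real) monoid" where
  "GZ = integer_group \<times>\<times> heisenberg_int"

definition S1 :: "(int \<times> real \<times> real \<times> real) set" where
  "S1 = symmetrize GZ {(1, 0, 0, 1), (1, 0, 0, -1), (0, 1, 0, 0), (0, 0, 1, 0)}"

definition S2 :: "(int \<times> real \<times> real \<times> real) set" where
  "S2 = symmetrize GZ {(1, 0, 0, 0), (0, 1, 0, 0), (0, 0, 1, 0)}"

abbreviation rho1 :: "int \<times> real \<times> real \<times> real \<Rightarrow> int \<times> real \<times> real \<times> real \<Rightarrow> real" where
  "rho1 \<equiv> word_metric GZ S1"

abbreviation rho2 :: "int \<times> real \<times> real \<times> real \<Rightarrow> int \<times> real \<times> real \<times> real \<Rightarrow> real" where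
  "rho2 \<equiv> word_metric GZ S2"

lemma group_heisenberg_real: "group heisenberg_real"
proof (rule groupI)
  fix x assume "x \<in> carrier heisenberg_real"
  obtain a b c where "x = (a,b,c)" by (cases x)
  then have "(-a,-b,-c) \<otimes>\<^bsub>heisenberg_real\<^esub> x = \<one>\<^bsub>heisenberg_real\<^esub>"
    by (simp add: heisenberg_real_def)
  then show "\<exists>y\<in>carrier heisenberg_real. y \<otimes>\<^bsub>heisenberg_real\<^esub> x = \<one>\<^bsub>heisenberg_real\<^esub>"
    by (rule bexI) (simp add: heisenberg_real_def)
qed (auto simp: heisenberg_real_def field_simps)

lemma inv_heisenberg_real: "inv\<^bsub>heisenberg_real\<^esub> (a, b, c) = (-a, -b, -c)"
  by (rule group.inv_equality[OF group_heisenberg_real]) (auto simp: heisenberg_real_def)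

lemma subgroup_heisenberg_int: "subgroup (carrier heisenberg_int) heisenberg_real"
  unfolding heisenberg_int_def
  by (simp, rule group.generate_is_subgroup[OF group_heisenberg_real]) (simp add: heisenberg_real_def)

lemma group_heisenberg_int: "group heisenberg_int"
  using group.subgroup_imp_group[OF group_heisenberg_real subgroup_heisenberg_int]
  by (simp add: heisenberg_int_def)

lemma group_GZ: "group GZ"
  unfolding GZ_def by (intro DirProd_group group_integer_group group_heisenberg_int)

lemma XY_in_heisenberg_int:
  "(1, 0, 0) \<in> carrier heisenberg_int" "(0, 1, 0) \<in> carrier heisenberg_int"
  by (auto simp: heisenberg_int_def intro: generate.incl)

lemma inv_heisenberg_int:
  assumes "(a, b, c) \<in> carrier heisenberg_int"
  shows "inv\<^bsub>heisenberg_int\<^esub> (a, b, c) = (-a, -b, -c)"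
  using group.m_inv_consistent[OF group_heisenberg_real subgroup_heisenberg_int assms]
  by (simp add: inv_heisenberg_real heisenberg_int_def)

lemma Z_in_heisenberg_int:
  "(0, 0, 1) \<in> carrier heisenberg_int" "(0, 0, -1) \<in> carrier heisenberg_int"
proof -
  interpret group heisenberg_int by (rule group_heisenberg_int)
  note XY = XY_in_heisenberg_int
  have "((1,0,0) \<otimes>\<^bsub>heisenberg_int\<^esub> (0,1,0)) \<otimes>\<^bsub>heisenberg_int\<^esub>
        (inv\<^bsub>heisenberg_int\<^esub> (1,0,0) \<otimes>\<^bsub>heisenberg_int\<^esub> inv\<^bsub>heisenberg_int\<^esub> (0,1,0)) \<in> carrier heisenberg_int"
    using XY by (intro m_closed inv_closed)
  then show *: "(0, 0, 1) \<in> carrier heisenberg_int"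
    by (simp add: inv_heisenberg_int XY) (simp add: heisenberg_int_def heisenberg_real_def)
  show "(0, 0, -1) \<in> carrier heisenberg_int"
    using inv_closed[OF *] by (simp add: inv_heisenberg_int *)
qed

lemma mult_GZ:
  "(n, x, y, z) \<otimes>\<^bsub>GZ\<^esub> (n', x', y', z') = (n + n', x + x', y + y', z + z' + (x * y' - y * x') / 2)"
  by (simp add: GZ_def heisenberg_int_def heisenberg_real_def integer_group_def)

lemma one_GZ: "\<one>\<^bsub>GZ\<^esub> = (0, 0, 0, 0)"
  by (simp add: GZ_def heisenberg_int_def heisenberg_real_def integer_group_def)

lemma inv_GZ:
  assumes "(n, x, y, z) \<in> carrier GZ"
  shows "inv\<^bsub>GZ\<^esub> (n, x, y, z) = (-n, -x, -y, -z)"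
proof -
  have "(x, y, z) \<in> carrier heisenberg_int" using assms by (simp add: GZ_def)
  then show ?thesis
    unfolding GZ_def
    by (subst inv_DirProd) (auto simp: group_heisenberg_int inv_heisenberg_int)
qed

lemma generators_in_GZ:
  "(1, 0, 0, 0) \<in> carrier GZ" "(0, 1, 0, 0) \<in> carrier GZ" "(0, 0, 1, 0) \<in> carrier GZ"
  "(1, 0, 0, 1) \<in> carrier GZ" "(1, 0, 0, -1) \<in> carrier GZ"
  using XY_in_heisenberg_int Z_in_heisenberg_int group.is_monoid[OF group_heisenberg_int, THEN monoid.one_closed]
  by (auto simp: GZ_def) (simp add: heisenberg_int_def heisenberg_real_def)

lemma S1_eq:
  "S1 = {(1, 0, 0, 1), (-1, 0, 0, -1), (1, 0, 0, -1), (-1, 0, 0, 1),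
         (0, 1, 0, 0), (0, -1, 0, 0), (0, 0, 1, 0), (0, 0, -1, 0)}"
  by (auto simp: S1_def symmetrize_def inv_GZ generators_in_GZ)

lemma S2_eq:
  "S2 = {(1, 0, 0, 0), (-1, 0, 0, 0), (0, 1, 0, 0), (0, -1, 0, 0), (0, 0, 1, 0), (0, 0, -1, 0)}"
  by (auto simp: S2_def symmetrize_def inv_GZ generators_in_GZ)

lemma generate_GZ:
  assumes H: "subgroup H GZ"
    and gens: "(1, 0, 0, 0) \<in> H" "(0, 1, 0, 0) \<in> H" "(0, 0, 1, 0) \<in> H"
  shows "H = carrier GZ"
proof
  interpret group GZ by (rule group_GZ)
  show "H \<subseteq> carrier GZ" by (rule subgroup.subset[OF H])
  have inv_H: "(-n, -x, -y, -z) \<in> H" if "(n, x, y, z) \<in> H" for n x y z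
    using subgroup.m_inv_closed[OF H that] subgroup.mem_carrier[OF H that] by (simp add: inv_GZ)
  have mult_H: "a \<otimes>\<^bsub>GZ\<^esub> b \<in> H" if "a \<in> H" "b \<in> H" for a b
    using subgroup.m_closed[OF H that] .
  have heis: "(0, h) \<in> H" if "h \<in> generate heisenberg_real {(1, 0, 0), (0, 1, 0)}" for h
    using that
  proof (induction rule: generate.induct)
    case one
    show ?case using subgroup.one_closed[OF H] by (simp add: one_GZ heisenberg_real_def)
  next
    case (incl h)
    then show ?case using gens by auto
  next
    case (inv h)
    then show ?case using gens inv_H by (force simp: inv_heisenberg_real)
  next
    case (eng h1 h2)
    have "(0, h1) \<otimes>\<^bsub>GZ\<^esub> (0, h2) = (0, h1 \<otimes>\<^bsub>heisenberg_real\<^esub> h2)"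
      by (simp add: GZ_def heisenberg_int_def integer_group_def)
    then show ?case using mult_H[OF eng.IH] by simp
  qed
  have nat: "(int k, 0, 0, 0) \<in> H" for k
  proof (induction k)
    case 0
    show ?case using subgroup.one_closed[OF H] by (simp add: one_GZ)
  next
    case (Suc k)
    show ?case using mult_H[OF gens(1) Suc] by (simp add: mult_GZ)
  qed
  have int: "(n, 0, 0, 0) \<in> H" for n :: int
    using nat[of "nat n"] inv_H[OF nat[of "nat (-n)"]] by (cases "n \<ge> 0") auto
  show "carrier GZ \<subseteq> H"
  proof
    fix g assume g: "g \<in> carrier GZ"
    obtain n x y z where g_eq: "g = (n, x, y, z)" by (cases g)
    have "(0, x, y, z) \<in> H" using g by (intro heis) (simp add: g_eq GZ_def heisenberg_int_def)
    from mult_H[OF int[of n] this] show "g \<in> H" by (simp add: g_eq mult_GZ)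
  qed
qed

lemma generate_S2: "generate GZ S2 = carrier GZ"
  by (intro generate_GZ group.generate_is_subgroup[OF group_GZ])
    (auto simp: S2_def symmetrize_def generators_in_GZ group.inv_closed[OF group_GZ] intro: generate.incl)

lemma generate_S1: "generate GZ S1 = carrier GZ"
proof (rule generate_GZ)
  have sub: "S1 \<subseteq> carrier GZ"
    by (auto simp: S1_def symmetrize_def generators_in_GZ group.inv_closed[OF group_GZ])
  show sg: "subgroup (generate GZ S1) GZ"
    by (rule group.generate_is_subgroup[OF group_GZ sub])
  note incl = generate.incl[of _ S1 GZ]
  show X: "(0, 1, 0, 0) \<in> generate GZ S1" and Y: "(0, 0, 1, 0) \<in> generate GZ S1"
    by (rule incl, simp add: S1_eq)+
  have gens: "(1, 0, 0, 1) \<in> generate GZ S1" "(0, -1, 0, 0) \<in> generate GZ S1" "(0, 0, -1, 0) \<in> generate GZ S1"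
    by (rule incl, simp add: S1_eq)+
  have "(1, 0, 0, 1) \<otimes>\<^bsub>GZ\<^esub> (((0, 0, 1, 0) \<otimes>\<^bsub>GZ\<^esub> (0, 1, 0, 0)) \<otimes>\<^bsub>GZ\<^esub> ((0, 0, -1, 0) \<otimes>\<^bsub>GZ\<^esub> (0, -1, 0, 0)))
        \<in> generate GZ S1"
    using X Y gens by (intro generate.eng)
  then show "(1, 0, 0, 0) \<in> generate GZ S1" by (simp add: mult_GZ)
qed

lemma word_value_simps [simp]:
  "word_value G [] = \<one>\<^bsub>G\<^esub>" "word_value G (w # ws) = w \<otimes>\<^bsub>G\<^esub> word_value G ws"
  by (simp_all add: word_value_def)

lemma (in group) word_value_closed: "set ws \<subseteq> carrier G \<Longrightarrow> word_value G ws \<in> carrier G"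
  by (induction ws) auto

lemma (in group) word_value_append:
  "set us \<subseteq> carrier G \<Longrightarrow> set vs \<subseteq> carrier G \<Longrightarrow> word_value G (us @ vs) = word_value G us \<otimes> word_value G vs"
  by (induction us) (auto simp: word_value_closed m_assoc)

lemma (in group) word_value_inv:
  "set ws \<subseteq> carrier G \<Longrightarrow> word_value G (rev (map (m_inv G) ws)) = inv (word_value G ws)"
proof (induction ws)
  case (Cons w ws)
  then have "set (rev (map (m_inv G) ws)) \<subseteq> carrier G" by auto
  with Cons show ?case by (simp add: word_value_append word_value_closed inv_mult_group)
qed simp

lemma symmetrize_inv_closed:
  assumes "group G" "A \<subseteq> carrier G" "s \<in> symmetrize G A"
  shows "inv\<^bsub>G\<^esub> s \<in> symmetrize G A"
  using assms group.inv_inv[OF assms(1)] by (auto simp: symmetrize_def subset_iff)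

lemma (in group) word_metric_is_metric:
  assumes A: "A \<subseteq> carrier G" and gen: "generate G (symmetrize G A) = carrier G"
  shows "Metric_space (carrier G) (word_metric G (symmetrize G A))"
proof -
  let ?S = "symmetrize G A"
  let ?len = "word_length G ?S"
  have S: "?S \<subseteq> carrier G" using A by (auto simp: symmetrize_def)
  have inv_S: "inv s \<in> ?S" if "s \<in> ?S" for s
    by (rule symmetrize_inv_closed[OF is_group A that])
  have word: "\<exists>ws. set ws \<subseteq> ?S \<and> word_value G ws = g" if "g \<in> carrier G" for g
    using that unfolding gen[symmetric]
  proof (induction rule: generate.induct)
    case one
    show ?case by (rule exI[of _ "[]"]) simp
  next
    case (incl h)
    then show ?case using S by (intro exI[of _ "[h]"]) auto
  next
    case (inv h)
    then show ?case using S inv_S by (intro exI[of _ "[inv h]"]) auto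
  next
    case (eng h1 h2)
    then obtain us vs where uv: "set us \<subseteq> ?S" "word_value G us = h1" "set vs \<subseteq> ?S" "word_value G vs = h2"
      by blast
    then show ?case using S by (intro exI[of _ "us @ vs"]) (subst word_value_append, auto)
  qed
  have len_ex: "\<exists>ws. set ws \<subseteq> ?S \<and> length ws = ?len g \<and> word_value G ws = g" if "g \<in> carrier G" for g
    unfolding word_length_def by (rule LeastI_ex) (use word[OF that] in auto)
  have len_le: "?len (word_value G ws) \<le> length ws" if "set ws \<subseteq> ?S" for ws
    unfolding word_length_def by (rule Least_le) (use that in auto)
  have len_inv_le: "?len (inv g) \<le> ?len g" if g: "g \<in> carrier G" for g
  proof -
    obtain ws where ws: "set ws \<subseteq> ?S" "length ws = ?len g" "word_value G ws = g"
      using len_ex[OF g] by auto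
    have "?len (word_value G (rev (map (m_inv G) ws))) \<le> length (rev (map (m_inv G) ws))"
      using ws(1) inv_S by (intro len_le) auto
    then show ?thesis using ws S word_value_inv[of ws] by simp
  qed
  have len_inv: "?len (inv g) = ?len g" if g: "g \<in> carrier G" for g
    using len_inv_le[OF g] len_inv_le[of "inv g"] g by simp
  have len_mult: "?len (g \<otimes> h) \<le> ?len g + ?len h" if g: "g \<in> carrier G" and h: "h \<in> carrier G" for g h
  proof -
    obtain us vs where "set us \<subseteq> ?S" "length us = ?len g" "word_value G us = g"
      "set vs \<subseteq> ?S" "length vs = ?len h" "word_value G vs = h"
      using len_ex[OF g] len_ex[OF h] by auto
    then show ?thesis using len_le[of "us @ vs"] S word_value_append[of us vs] by auto
  qed
  have len_0: "?len g = 0 \<longleftrightarrow> g = \<one>" if g: "g \<in> carrier G" for g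
    using len_ex[OF g] len_le[of "[]"] by auto
  show ?thesis
  proof
    show "0 \<le> word_metric G ?S x y" for x y by (simp add: word_metric_def)
    show "word_metric G ?S x y = word_metric G ?S y x" for x y
      using len_inv[of "inv x \<otimes> y"]
      by (cases "x \<in> carrier G \<and> y \<in> carrier G") (auto simp: word_metric_def inv_mult_group)
    show "word_metric G ?S x y = 0 \<longleftrightarrow> x = y" if "x \<in> carrier G" "y \<in> carrier G" for x y
      using that len_0[of "inv x \<otimes> y"]
      by (simp add: word_metric_def) (metis inv_solve_left one_closed r_one)
    show "word_metric G ?S x z \<le> word_metric G ?S x y + word_metric G ?S y z"
      if "x \<in> carrier G" "y \<in> carrier G" "z \<in> carrier G" for x y z
    proof -
      have "(inv x \<otimes> y) \<otimes> (inv y \<otimes> z) = inv x \<otimes> z"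
        using that by (simp add: m_assoc flip: m_assoc[of y "inv y" z])
      then show ?thesis
        using that len_mult[of "inv x \<otimes> y" "inv y \<otimes> z"] by (simp add: word_metric_def)
    qed
  qed
qed

lemma Metric_space_rho1: "Metric_space (carrier GZ) rho1"
  using generate_S1 unfolding S1_def
  by (intro group.word_metric_is_metric[OF group_GZ]) (auto simp: generators_in_GZ)

lemma Metric_space_rho2: "Metric_space (carrier GZ) rho2"
  using generate_S2 unfolding S2_def
  by (intro group.word_metric_is_metric[OF group_GZ]) (auto simp: generators_in_GZ)

end

theory Submission
  imports Defs
begin

text \<open>Write \<open>d\<close> for the sub-Finsler \<open>\<ell>\<^sup>1\<close> metric on \<open>H\<^sub>3(\<real>)\<close>. A horizontal path of length \<open>c\<close> can
  be cut into \<open>M\<close> pieces and each piece rounded to an integral corner; the area lost is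
  \<open>O(c\<^sup>2 / M)\<close>, so the word metric of \<open>H\<^sub>3(\<int>)\<close> is at most \<open>(1 + \<epsilon>) d + K\<close>. The
  central parts of the letters of \<open>S1\<close> change lengths only by \<open>O(sqrt n)\<close>, hence
  both cones are \<open>\<real> \<times> H\<^sub>3(\<real>)\<close> with the \<open>\<ell>\<^sup>1\<close> product metric.

  A \<open>(1, C)\<close>-quasi-isometry almost preserves near-midpoints. For \<open>\<rho>\<^sub>1\<close> the near-midpoints between \<open>1\<close>
  and \<open>(n; 0, 0, \<plusminus>n)\<close> form sets of bounded diameter, because nearly all letters of a near-geodesic
  must be \<open>(1; 0, 0, \<plusminus>1)\<close>. For \<open>\<rho>\<^sub>2\<close> this happens only for pairs whose difference \<open>(v; h)\<close>
  has \<open>h\<close> bounded: if both \<open>v\<close> and \<open>h\<close> are large, the two factors can be traversed in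
  either order, and if \<open>h\<close> is large, then conjugating parts of a geodesic by single letters moves
  its midpoint far along the centre. So the two images differ from the image of \<open>1\<close> by about \<open>\<plusminus>n\<close> in
  the first factor, and their mutual distance is bounded or about \<open>2n\<close>, whereas the
  \<open>\<rho>\<^sub>1\<close>-distance of the two points has order \<open>sqrt n\<close>.\<close>

section \<open>Horizontal paths in the Heisenberg group\<close>

abbreviation hmult :: "real \<times> real \<times> real \<Rightarrow> real \<times> real \<times> real \<Rightarrow> real \<times> real \<times> real"
    (infixl "\<odot>" 70) where
  "g \<odot> h \<equiv> g \<otimes>\<^bsub>heisenberg_real\<^esub> h"

lemma hmult_simp [simp]:
  "(x, y, z) \<odot> (x', y', z') = (x + x', y + y', z + z' + (x * y' - y * x') / 2)"
  by (simp add: heisenberg_real_def)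

lemma hmult_assoc: "g \<odot> h \<odot> k = g \<odot> (h \<odot> k)"
  by (cases g; cases h; cases k) (simp add: field_simps)

lemma hmult_0 [simp]: "g \<odot> 0 = g" "0 \<odot> g = g"
  by (cases g; simp add: zero_prod_def)+

text \<open>In exponential coordinates inversion is coordinatewise negation and the identity is the
  zero vector, so \<open>-\<close> and \<open>0\<close> of the product type double as group
  operations.\<close>

lemma hmult_minus [simp]: "g \<odot> (- g) = 0" "(- g) \<odot> g = 0"
  by (cases g; simp add: zero_prod_def)+

lemma hmult_minus_cancel [simp]: "g \<odot> (- g \<odot> h) = h" "- g \<odot> (g \<odot> h) = h"
  by (simp_all flip: hmult_assoc)

lemma minus_hmult: "- (g \<odot> h) = - h \<odot> - g"
  by (cases g; cases h) (simp add: field_simps)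

text \<open>\<open>hpath T c g\<close> says that \<open>g\<close> is the endpoint of a horizontal path made of axis-parallel
  segments with lengths in \<open>T\<close>, of total length \<open>c\<close>. With \<open>T = \<real>\<close> this gives the
  sub-Finsler metric, with \<open>T = \<int>\<close> or \<open>T = {- 1, 0, 1}\<close> the word metric.\<close>

inductive hpath :: "real set \<Rightarrow> real \<Rightarrow> real \<times> real \<times> real \<Rightarrow> bool" for T where
  hpath_0: "hpath T 0 0"
| hpath_step: "hpath T c g \<Longrightarrow> s \<in> T \<Longrightarrow> t \<in> T \<Longrightarrow> s = 0 \<or> t = 0 \<Longrightarrow>
    hpath T (c + \<bar>s\<bar> + \<bar>t\<bar>) (g \<odot> (s, t, 0))"

lemma hpath_mono: "hpath T c g \<Longrightarrow> T \<subseteq> U \<Longrightarrow> hpath U c g"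
  by (induction rule: hpath.induct) (auto intro: hpath.intros)

lemma hpath_Ints_UNIV: "hpath \<int> c g \<Longrightarrow> hpath UNIV c g"
  by (erule hpath_mono) simp

lemma hpath_letter: "s \<in> T \<Longrightarrow> t \<in> T \<Longrightarrow> s = 0 \<or> t = 0 \<Longrightarrow> hpath T (\<bar>s\<bar> + \<bar>t\<bar>) (s, t, 0)"
  using hpath_step[OF hpath_0, of s T t] by simp

lemma hpath_append:
  assumes "hpath T c g" "hpath T c' h" shows "hpath T (c + c') (g \<odot> h)"
  using assms(2)
proof (induction rule: hpath.induct)
  case hpath_0 then show ?case using assms(1) by simp
next
  case (hpath_step c' h s t)
  from hpath.hpath_step[OF hpath_step.IH hpath_step.hyps(2,3,4)] show ?case
    by (simp add: hmult_assoc add_ac)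
qed

lemma hpath_nonneg: "hpath T c g \<Longrightarrow> 0 \<le> c"
  by (induction rule: hpath.induct) auto

lemma hpath_minus:
  assumes "hpath T c g" and T: "\<And>t. t \<in> T \<Longrightarrow> - t \<in> T"
  shows "hpath T c (- g)"
  using assms(1)
proof (induction rule: hpath.induct)
  case hpath_0 show ?case by (simp add: hpath.hpath_0)
next
  case (hpath_step c g s t)
  from hpath_append[OF hpath_letter[OF T[OF hpath_step.hyps(2)] T[OF hpath_step.hyps(3)]] hpath_step.IH]
    hpath_step.hyps(4)
  show ?case by (simp add: minus_hmult add_ac)
qed

text \<open>A step \<open>(s, t, 0)\<close> changes \<open>z\<close> by
  \<open>(x * t - y * s) / 2\<close>, and the horizontal coordinates never exceed the length run so
  far. Hence \<open>z\<close> grows at most quadratically.\<close>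

lemma hpath_bounds:
  assumes "hpath T c (x, y, z)" shows "\<bar>x\<bar> + \<bar>y\<bar> \<le> c" "\<bar>z\<bar> \<le> c\<^sup>2"
proof -
  have "\<bar>fst g\<bar> + \<bar>fst (snd g)\<bar> \<le> c \<and> \<bar>snd (snd g)\<bar> \<le> c\<^sup>2" if "hpath T c g" for c g
    using that
  proof (induction rule: hpath.induct)
    case hpath_0 show ?case by simp
  next
    case (hpath_step c g s t)
    obtain x y z where g: "g = (x, y, z)" by (cases g)
    have c: "0 \<le> c" using hpath_nonneg[OF hpath_step.hyps(1)] .
    have xy: "\<bar>x\<bar> + \<bar>y\<bar> \<le> c" "\<bar>z\<bar> \<le> c\<^sup>2" using hpath_step.IH by (auto simp: g)
    have "\<bar>x * t - y * s\<bar> \<le> \<bar>x\<bar> * \<bar>t\<bar> + \<bar>y\<bar> * \<bar>s\<bar>"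
      using abs_triangle_ineq4[of "x * t" "y * s"] by (simp add: abs_mult)
    also have "\<dots> \<le> c * \<bar>t\<bar> + c * \<bar>s\<bar>"
      using xy(1) by (intro add_mono mult_right_mono) auto
    finally have 1: "\<bar>x * t - y * s\<bar> \<le> c * \<bar>t\<bar> + c * \<bar>s\<bar>" .
    have "\<bar>z + (x * t - y * s) / 2\<bar> \<le> \<bar>z\<bar> + \<bar>x * t - y * s\<bar>"
      using abs_triangle_ineq[of z "(x * t - y * s) / 2"] abs_ge_zero[of "x * t - y * s"]
      unfolding abs_divide by (simp del: abs_ge_zero)
    also have "\<dots> \<le> c\<^sup>2 + (c * \<bar>t\<bar> + c * \<bar>s\<bar>)" using 1 xy(2) by linarith
    also have "\<dots> \<le> (c + \<bar>s\<bar> + \<bar>t\<bar>)\<^sup>2"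
      using c by (simp add: power2_eq_square algebra_simps)
    finally show ?case using xy(1) by (auto simp: g)
  qed
  from this[OF assms] show "\<bar>x\<bar> + \<bar>y\<bar> \<le> c" "\<bar>z\<bar> \<le> c\<^sup>2" by auto
qed

text \<open>Only the segment containing the cut point is split. Since \<open>T\<close> is closed
  under subtraction, both parts have lengths in \<open>T\<close> once \<open>a\<close> is in
  \<open>T\<close>; so real paths can be cut anywhere and integral paths at integers.\<close>

lemma hpath_cut:
  assumes "hpath T c g" and T0: "0 \<in> T" and T: "\<And>s t. s \<in> T \<Longrightarrow> t \<in> T \<Longrightarrow> s - t \<in> T"
    and "a \<in> T" "0 \<le> a" "a \<le> c"
  obtains g1 g2 where "g = g1 \<odot> g2" "hpath T a g1" "hpath T (c - a) g2"
proof -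
  have Tm: "- t \<in> T" if "t \<in> T" for t using T[OF T0 that] by simp
  have Tp: "s + t \<in> T" if "s \<in> T" "t \<in> T" for s t using T[OF that(1) Tm[OF that(2)]] by simp
  have Tabs: "\<bar>t\<bar> \<in> T" if "t \<in> T" for t using that Tm by (cases "t \<ge> 0") auto
  have Tsgn: "sgn s * t \<in> T" if "t \<in> T" for s t :: real using that Tm T0 by (auto simp: sgn_if)
  have "\<exists>g1 g2. g = g1 \<odot> g2 \<and> hpath T a g1 \<and> hpath T (c - a) g2 \<and> c \<in> T" if "a \<le> c"
    using assms(1) that
  proof (induction rule: hpath.induct)
    case hpath_0
    then have "a = 0" using \<open>0 \<le> a\<close> by simp
    then show ?case using T0 hpath.hpath_0[of T] by (intro exI[of _ 0]) simp
  next
    case (hpath_step c g s t)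
    have cT: "c \<in> T" using hpath_step.hyps(1)
      by (induction rule: hpath.induct) (auto intro!: Tp Tabs T0)
    then have cT': "c + \<bar>s\<bar> + \<bar>t\<bar> \<in> T" using hpath_step.hyps by (intro Tp Tabs)
    show ?case
    proof (cases "a \<le> c")
      case True
      from hpath_step.IH[OF True] obtain g1 g2
        where g: "g = g1 \<odot> g2" "hpath T a g1" "hpath T (c - a) g2" by blast
      from hpath.hpath_step[OF g(3) hpath_step.hyps(2-4)]
      have "hpath T (c + \<bar>s\<bar> + \<bar>t\<bar> - a) (g2 \<odot> (s, t, 0))" by (simp add: algebra_simps)
      with g cT' show ?thesis by (intro exI[of _ g1] exI[of _ "g2 \<odot> (s, t, 0)"]) (simp add: hmult_assoc)
    next
      case False
      \<comment> \<open>\<open>b\<close> and \<open>d\<close> are the lengths of the last segment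
        before and after the cut point; \<open>sgn\<close> supplies its direction.\<close>
      define b where "b = a - c"
      define d where "d = c + \<bar>s\<bar> + \<bar>t\<bar> - a"
      have b: "0 \<le> b" "b \<in> T" and d: "0 \<le> d" "d \<in> T"
        using False \<open>a \<in> T\<close> cT cT' hpath_step.prems by (auto simp: b_def d_def T)
      have st: "(s, t, 0) = (sgn s * b, sgn t * b, 0) \<odot> (sgn s * d, sgn t * d, 0)"
        using hpath_step.hyps(4) by (auto simp: b_def d_def abs_sgn algebra_simps)
      have sgn: "sgn s = 0 \<or> sgn t = 0" using hpath_step.hyps(4) by auto
      show ?thesis
      proof (cases "s = 0 \<and> t = 0")
        case True then show ?thesis using \<open>\<not> a \<le> c\<close> hpath_step.prems by simp
      next
        case False
        then have one: "\<bar>sgn s * e\<bar> + \<bar>sgn t * e\<bar> = e" if "0 \<le> e" for e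
          using hpath_step.hyps(4) that by (auto simp: abs_mult abs_sgn_eq)
        have 1: "hpath T (c + \<bar>sgn s * b\<bar> + \<bar>sgn t * b\<bar>) (g \<odot> (sgn s * b, sgn t * b, 0))"
          using b sgn by (intro hpath.hpath_step hpath_step.hyps(1) Tsgn) auto
        have 2: "hpath T (\<bar>sgn s * d\<bar> + \<bar>sgn t * d\<bar>) (sgn s * d, sgn t * d, 0)"
          using d sgn by (intro hpath_letter Tsgn) auto
        have "hpath T a (g \<odot> (sgn s * b, sgn t * b, 0))"
          using 1 one[OF b(1)] by (simp add: b_def add.assoc)
        moreover have "hpath T (c + \<bar>s\<bar> + \<bar>t\<bar> - a) (sgn s * d, sgn t * d, 0)"
          using 2 one[OF d(1)] by (simp add: d_def)
        ultimately show ?thesis using cT' unfolding st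
          by (intro exI conjI) (auto simp: hmult_assoc[symmetric] simp del: hmult_simp)
      qed
    qed
  qed
  with \<open>a \<le> c\<close> that show ?thesis by blast
qed

section \<open>Explicit paths and the integral lattice\<close>

lemma hpath_commutator:
  assumes "s \<in> T" "t \<in> T" "0 \<in> T" and T: "\<And>t. t \<in> T \<Longrightarrow> - t \<in> T"
  shows "hpath T (2 * (\<bar>s\<bar> + \<bar>t\<bar>)) (0, 0, s * t)"
proof -
  have X: "hpath T \<bar>r\<bar> (r, 0, 0)" and Y: "hpath T \<bar>r\<bar> (0, r, 0)" if "r \<in> T" for r
    using hpath_letter[of r T 0] hpath_letter[of 0 T r] that assms(3) by auto
  \<comment> \<open>The commutator runs around a rectangle with sides \<open>s\<close> and
    \<open>t\<close>, and its central coordinate is the signed area enclosed.\<close>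
  have eq: "(0, 0, s * t) = (s, 0, 0) \<odot> (0, t, 0) \<odot> ((- s, 0, 0) \<odot> (0, - t, 0))"
    by (simp add: field_simps)
  have "hpath T (\<bar>s\<bar> + \<bar>t\<bar> + (\<bar>- s\<bar> + \<bar>- t\<bar>)) (0, 0, s * t)"
    unfolding eq using assms by (intro hpath_append X Y T)
  then show ?thesis by (simp add: algebra_simps)
qed

lemma hpath_corner:
  assumes "s \<in> T" "t \<in> T" "0 \<in> T"
  shows "hpath T (\<bar>s\<bar> + \<bar>t\<bar>) (s, t, s * t / 2)"
  using hpath_append[OF hpath_letter[of s T 0] hpath_letter[of 0 T t]] assms by simp

text \<open>An L-shaped path to \<open>(x, y)\<close> encloses with its chord the area
  \<open>x * y / 2\<close>; the missing area is supplied by a loop around a square.\<close>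

lemma hpath_real: "hpath UNIV (\<bar>x\<bar> + \<bar>y\<bar> + 4 * sqrt \<bar>z - x * y / 2\<bar>) (x, y, z)"
proof -
  define k where "k = z - x * y / 2"
  have "hpath UNIV (2 * (\<bar>sgn k * sqrt \<bar>k\<bar>\<bar> + \<bar>sqrt \<bar>k\<bar>\<bar>)) (0, 0, sgn k * sqrt \<bar>k\<bar> * sqrt \<bar>k\<bar>)"
    by (intro hpath_commutator) auto
  moreover have "sgn k * sqrt \<bar>k\<bar> * sqrt \<bar>k\<bar> = k" by (simp add: sgn_if mult.assoc)
  moreover have "\<bar>sgn k * sqrt \<bar>k\<bar>\<bar> + \<bar>sqrt \<bar>k\<bar>\<bar> = 2 * sqrt \<bar>k\<bar>" by (auto simp: abs_mult sgn_if)
  ultimately have "hpath UNIV (4 * sqrt \<bar>k\<bar>) (0, 0, k)" by simp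
  from hpath_append[OF hpath_corner[of x UNIV y] this] show ?thesis
    by (simp add: k_def)
qed

text \<open>Write the absolute value of \<open>k\<close> as \<open>m * m + r\<close> with
  \<open>m\<close> the integer part of its root, so \<open>r \<le> 2 * m\<close>. A square loop of
  side \<open>m\<close> and a loop around a 1 by \<open>r\<close> rectangle have total length at
  most \<open>4 * m + 2 * (1 + r) \<le> 8 * m + 2\<close>.\<close>

lemma hpath_Ints_central:
  assumes "k \<in> \<int>"
  obtains c where "c \<le> 8 * sqrt \<bar>k\<bar> + 2" "hpath \<int> c (0, 0, k)"
proof -
  define m :: int where "m = \<lfloor>sqrt \<bar>k\<bar>\<rfloor>"
  have m: "0 \<le> m" "real_of_int m \<le> sqrt \<bar>k\<bar>" "sqrt \<bar>k\<bar> < real_of_int m + 1"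
    unfolding m_def by (simp, linarith, linarith)
  define r where "r = \<bar>k\<bar> - real_of_int m * real_of_int m"
  have "real_of_int m * real_of_int m \<le> sqrt \<bar>k\<bar> * sqrt \<bar>k\<bar>"
    using m by (intro mult_mono) auto
  then have r0: "0 \<le> r" by (simp add: r_def)
  have "sqrt \<bar>k\<bar> * sqrt \<bar>k\<bar> < (real_of_int m + 1) * (real_of_int m + 1)"
    using m by (intro mult_strict_mono) auto
  then have "r < 2 * real_of_int m + 1" by (simp add: r_def algebra_simps)
  moreover have rZ: "r \<in> \<int>" using assms by (auto simp: r_def)
  then obtain i where i: "r = real_of_int i" by (elim Ints_cases)
  ultimately have "real_of_int i < real_of_int (2 * m + 1)" by simp
  then have "i \<le> 2 * m" unfolding of_int_less_iff by simp
  then have r: "r \<le> 2 * real_of_int m" unfolding i by linarith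
  have sgn: "sgn k \<in> \<int>" by (auto simp: sgn_if)
  have "hpath \<int> (2 * (\<bar>sgn k * m\<bar> + \<bar>of_int m\<bar>) + 2 * (\<bar>sgn k\<bar> + \<bar>r\<bar>))
      ((0, 0, sgn k * m * m) \<odot> (0, 0, sgn k * r))"
    using rZ sgn by (intro hpath_append hpath_commutator) auto
  moreover have "sgn k * m * m + sgn k * r = k" by (simp add: r_def sgn_if)
  moreover have "2 * (\<bar>sgn k * m\<bar> + \<bar>of_int m\<bar>) + 2 * (\<bar>sgn k\<bar> + \<bar>r\<bar>) \<le> 8 * sqrt \<bar>k\<bar> + 2"
    using m r r0 by (auto simp: abs_mult sgn_if)
  ultimately show ?thesis by (intro that) auto
qed

lemma hpath_Ints_exists:
  assumes "x \<in> \<int>" "y \<in> \<int>" "z - x * y / 2 \<in> \<int>"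
  obtains c where "c \<le> \<bar>x\<bar> + \<bar>y\<bar> + 8 * sqrt \<bar>z - x * y / 2\<bar> + 2" "hpath \<int> c (x, y, z)"
proof -
  obtain c where c: "c \<le> 8 * sqrt \<bar>z - x * y / 2\<bar> + 2" "hpath \<int> c (0, 0, z - x * y / 2)"
    using hpath_Ints_central[OF assms(3)] .
  have "hpath \<int> (\<bar>x\<bar> + \<bar>y\<bar> + c) (x, y, z)"
    using hpath_append[OF hpath_corner[of x \<int> y] c(2)] assms by simp
  with c(1) show ?thesis by (intro that[of "\<bar>x\<bar> + \<bar>y\<bar> + c"]) auto
qed

text \<open>\<open>z - x * y / 2\<close> is the exponent \<open>k\<close> in the normal form exp(xX)
  exp(yY) exp(kZ). A step changes it by \<open>- y * s\<close>, because \<open>s * t = 0\<close>.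
  Together with \<open>hpath_Ints_exists\<close> this describes the integral lattice
  exactly.\<close>

lemma hpath_Ints_lattice:
  assumes "hpath \<int> c (x, y, z)" shows "x \<in> \<int>" "y \<in> \<int>" "z - x * y / 2 \<in> \<int>"
proof -
  have "fst g \<in> \<int> \<and> fst (snd g) \<in> \<int> \<and> snd (snd g) - fst g * fst (snd g) / 2 \<in> \<int>"
    if "hpath \<int> c g" for c g
    using that
  proof (induction rule: hpath.induct)
    case hpath_0 show ?case by simp
  next
    case (hpath_step c g s t)
    obtain x y z where g: "g = (x, y, z)" by (cases g)
    have "z + (x * t - y * s) / 2 - (x + s) * (y + t) / 2 = (z - x * y / 2) - y * s"
      using hpath_step.hyps(4) by (auto simp: field_simps)
    also have "\<dots> \<in> \<int>"
    proof (rule Ints_diff)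
      show "z - x * y / 2 \<in> \<int>" "y * s \<in> \<int>"
        using hpath_step.IH hpath_step.hyps(2) by (simp_all add: g)
    qed
    finally show ?case using hpath_step by (auto simp: g)
  qed
  from this[OF assms] show "x \<in> \<int>" "y \<in> \<int>" "z - x * y / 2 \<in> \<int>" by auto
qed

text \<open>An integral segment splits into unit letters without changing the total length, so
  lengths of integral paths are lengths of words.\<close>

lemma hpath_unit:
  assumes "hpath \<int> c g" shows "hpath {- 1, 0, 1} c g"
  using assms
proof (induction rule: hpath.induct)
  case hpath_0 show ?case by (rule hpath.hpath_0)
next
  case (hpath_step c g s t)
  have power: "hpath {- 1, 0, 1} (real n * (\<bar>e\<bar> + \<bar>f\<bar>)) (n * e, n * f, 0)"
    if "e \<in> {- 1, 0, 1}" "f \<in> {- 1, 0, 1}" "e = 0 \<or> f = 0" for n :: nat and e f :: real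
  proof (induction n)
    case 0 show ?case using hpath.hpath_0 by (simp add: zero_prod_def)
  next
    case (Suc n)
    from hpath.hpath_step[OF Suc that] show ?case using that by (auto simp: algebra_simps)
  qed
  obtain i j where ij: "s = of_int i" "t = of_int j"
    using hpath_step.hyps by (auto elim!: Ints_cases)
  define n where "n = nat (\<bar>i\<bar> + \<bar>j\<bar>)"
  have "real n * sgn s = s" "real n * sgn t = t"
    using hpath_step.hyps(4) by (auto simp: n_def ij sgn_if)
  moreover have "real n * (\<bar>sgn s\<bar> + \<bar>sgn t\<bar>) = \<bar>s\<bar> + \<bar>t\<bar>"
    using hpath_step.hyps(4) by (auto simp: n_def ij sgn_if)
  moreover have "hpath {- 1, 0, 1} (real n * (\<bar>sgn s\<bar> + \<bar>sgn t\<bar>)) (n * sgn s, n * sgn t, 0)"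
    using hpath_step.hyps(4) by (intro power) (auto simp: sgn_if)
  ultimately show ?case using hpath_append[OF hpath_step.IH, of "\<bar>s\<bar> + \<bar>t\<bar>"] by (simp add: add_ac)
qed

section \<open>The sub-Finsler metric and its integral approximation\<close>

lemma hpath_cut_UNIV:
  assumes "hpath UNIV c g" "0 \<le> a" "a \<le> c"
  shows "\<exists>g1 g2. g = g1 \<odot> g2 \<and> hpath UNIV a g1 \<and> hpath UNIV (c - a) g2"
  by (rule hpath_cut[OF assms(1) UNIV_I _ UNIV_I assms(2,3)]) blast+

text \<open>The l1 sub-Finsler distance from the identity; paths nearly realising it come from
  \<open>hlen_lessD\<close>.\<close>

definition hlen :: "real \<times> real \<times> real \<Rightarrow> real" where
  "hlen g = Inf {c. hpath UNIV c g}"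

lemma hlen_le: "hpath UNIV c g \<Longrightarrow> hlen g \<le> c"
  unfolding hlen_def by (rule cInf_lower) (auto intro!: bdd_belowI[of _ 0] dest: hpath_nonneg)

lemma hlen_lessD:
  assumes "hlen g < c" obtains c' where "c' < c" "hpath UNIV c' g"
proof -
  have "{c. hpath UNIV c g} \<noteq> {}" using hpath_real by (cases g) blast
  from cInf_lessD[OF this assms[unfolded hlen_def]] show ?thesis using that by auto
qed

lemma hlen_geI:
  assumes "\<And>c. hpath UNIV c g \<Longrightarrow> b \<le> c" shows "b \<le> hlen g"
proof (rule ccontr)
  assume "\<not> b \<le> hlen g"
  then obtain c where "c < b" "hpath UNIV c g" using hlen_lessD[of g b] by auto
  with assms[of c] show False by simp
qed

lemma hlen_nonneg: "0 \<le> hlen g"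
  by (rule hlen_geI) (rule hpath_nonneg)

lemma hlen_hmult: "hlen (g \<odot> h) \<le> hlen g + hlen h"
proof (rule field_le_epsilon)
  fix e :: real assume e: "e > 0"
  obtain c where c: "c < hlen g + e / 2" "hpath UNIV c g"
    using hlen_lessD[of g "hlen g + e / 2"] e by auto
  obtain d where d: "d < hlen h + e / 2" "hpath UNIV d h"
    using hlen_lessD[of h "hlen h + e / 2"] e by auto
  show "hlen (g \<odot> h) \<le> hlen g + hlen h + e"
    using hlen_le[OF hpath_append[OF c(2) d(2)]] c(1) d(1) by simp
qed

lemma hlen_minus: "hlen (- g) = hlen g"
proof -
  have "hlen (- g) \<le> hlen g" for g
    by (rule hlen_geI) (rule hlen_le, rule hpath_minus, auto)
  from this[of g] this[of "- g"] show ?thesis by simp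
qed

text \<open>These bounds confine balls of the cone to Euclidean boxes, while
  \<open>hlen_upper\<close> gives continuity; compactness of balls rests on both.\<close>

lemma hlen_bounds: "\<bar>x\<bar> + \<bar>y\<bar> \<le> hlen (x, y, z)" "sqrt \<bar>z\<bar> \<le> hlen (x, y, z)"
  by (rule hlen_geI, erule hpath_bounds)
    (rule hlen_geI, rule real_le_lsqrt, auto dest: hpath_bounds hpath_nonneg)

lemma hlen_upper: "hlen (x, y, z) \<le> \<bar>x\<bar> + \<bar>y\<bar> + 4 * sqrt \<bar>z - x * y / 2\<bar>"
  by (rule hlen_le) (rule hpath_real)

lemma hlen_eq_0_iff: "hlen g = 0 \<longleftrightarrow> g = 0"
proof
  assume "hlen g = 0"
  moreover obtain x y z where g: "g = (x, y, z)" by (cases g)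
  ultimately have "\<bar>x\<bar> + \<bar>y\<bar> \<le> 0" "sqrt \<bar>z\<bar> \<le> 0" using hlen_bounds(1)[of x y z] hlen_bounds(2)[of z x y] by auto
  moreover from calculation have "x = 0" "y = 0" by linarith+
  ultimately show "g = 0" by (simp add: g zero_prod_def)
next
  assume "g = 0"
  then show "hlen g = 0" using hlen_le[OF hpath_0] hlen_nonneg[of 0] by simp
qed

text \<open>For \<open>s > 0\<close> an automorphism with weight one on horizontal directions and
  weight two on the centre; it scales \<open>hlen\<close> by \<open>s\<close>.\<close>

definition dilate :: "real \<Rightarrow> real \<times> real \<times> real \<Rightarrow> real \<times> real \<times> real" where
  "dilate s = (\<lambda>(x, y, z). (s * x, s * y, s\<^sup>2 * z))"

lemma dilate_hmult: "dilate s (g \<odot> h) = dilate s g \<odot> dilate s h"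
  by (cases g; cases h) (simp add: dilate_def power2_eq_square field_simps)

lemma dilate_minus: "dilate s (- g) = - dilate s g"
  by (cases g) (simp add: dilate_def)

lemma dilate_dilate: "dilate s (dilate t g) = dilate (s * t) g"
  by (cases g) (simp add: dilate_def power_mult_distrib mult.assoc)

lemma dilate_1: "dilate 1 g = g"
  by (cases g) (simp add: dilate_def)

lemma hpath_dilate: "hpath UNIV c g \<Longrightarrow> hpath UNIV (\<bar>s\<bar> * c) (dilate s g)"
proof (induction rule: hpath.induct)
  case hpath_0 show ?case using hpath.hpath_0 by (simp add: dilate_def zero_prod_def)
next
  case (hpath_step c g a b)
  have "hpath UNIV (\<bar>s\<bar> * c + \<bar>s * a\<bar> + \<bar>s * b\<bar>) (dilate s g \<odot> (s * a, s * b, 0))"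
    using hpath_step by (intro hpath.hpath_step) auto
  then show ?case
    by (simp add: dilate_hmult abs_mult distrib_left add.assoc) (simp add: dilate_def)
qed

lemma hlen_dilate: "s > 0 \<Longrightarrow> hlen (dilate s g) = s * hlen g"
proof -
  have le: "hlen (dilate s g) \<le> s * hlen g" if "s > 0" for s g
  proof -
    have "hlen (dilate s g) / s \<le> hlen g"
      using that hlen_le[OF hpath_dilate[of _ g s]] by (intro hlen_geI) (simp add: divide_simps mult.commute)
    then show ?thesis using that by (simp add: divide_simps mult.commute)
  qed
  assume s: "s > 0"
  have "hlen g \<le> (1 / s) * hlen (dilate s g)"
    using le[of "1 / s" "dilate s g"] s by (simp add: dilate_dilate dilate_1)
  then show ?thesis using le[OF s, of g] s by (simp add: divide_simps mult.commute)
qed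

text \<open>A back-and-forth detour along the first axis absorbs surplus length.\<close>

lemma hpath_pad:
  assumes "hpath UNIV c g" "c \<le> c'" shows "hpath UNIV c' g"
proof -
  define s where "s = (c' - c) / 2"
  have "hpath UNIV (\<bar>s\<bar> + \<bar>0\<bar> + (\<bar>- s\<bar> + \<bar>0\<bar>)) ((s, 0, 0) \<odot> (- s, 0, 0))"
    by (intro hpath_append hpath_letter) auto
  then have "hpath UNIV (c' - c) 0" using assms(2) by (simp add: s_def zero_prod_def)
  from hpath_append[OF assms(1) this] show ?thesis by simp
qed

section \<open>Rounding real paths to integral ones\<close>

lemma truncate_exists:
  fixes p :: real obtains p' where "p' \<in> \<int>" "\<bar>p'\<bar> \<le> \<bar>p\<bar>" "\<bar>p - p'\<bar> \<le> 1"
proof (cases "p \<ge> 0")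
  case True then show ?thesis by (intro that[of "of_int \<lfloor>p\<rfloor>"]) (auto, linarith+)
next
  case False then show ?thesis by (intro that[of "of_int \<lceil>p\<rceil>"]) (auto, linarith+)
qed

lemma abs_mult_diff_le:
  fixes x q x' q' :: real
  assumes "\<bar>x - x'\<bar> \<le> M" "\<bar>q - q'\<bar> \<le> 1"
  shows "\<bar>x * q - x' * q'\<bar> \<le> \<bar>x\<bar> + M * \<bar>q'\<bar>"
proof -
  have "x * q - x' * q' = x * (q - q') + (x - x') * q'" by (simp add: algebra_simps)
  then have "\<bar>x * q - x' * q'\<bar> \<le> \<bar>x\<bar> * \<bar>q - q'\<bar> + \<bar>x - x'\<bar> * \<bar>q'\<bar>"
    using abs_triangle_ineq[of "x * (q - q')" "(x - x') * q'"] by (simp add: abs_mult)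
  also have "\<dots> \<le> \<bar>x\<bar> * 1 + M * \<bar>q'\<bar>"
    using assms by (intro add_mono mult_mono) auto
  finally show ?thesis by simp
qed

text \<open>Cut the path into \<open>M\<close> pieces of length \<open>a\<close> and replace each piece by an integral corner with
  truncated displacement; the enclosed areas lost are at most \<open>a\<^sup>2\<close> per piece, hence of
  order \<open>(M * a)\<^sup>2 / M\<close> in total.\<close>

lemma hpath_truncate:
  assumes "hpath UNIV (real M * a) (x, y, z)" "0 \<le> a"
  shows "\<exists>x' y' z' c. hpath \<int> c (x', y', z') \<and> c \<le> real M * a \<and>
    \<bar>x - x'\<bar> \<le> real M \<and> \<bar>y - y'\<bar> \<le> real M \<and> \<bar>z - z'\<bar> \<le> 2 * real M * a\<^sup>2 + 2 * (real M)\<^sup>2 * a"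
  using assms(1)
proof (induction M arbitrary: x y z)
  case 0
  then have path: "hpath UNIV 0 (x, y, z)" by simp
  have "x = 0" "y = 0" "z = 0" using hpath_bounds[OF path] by (linarith, linarith, simp)
  then show ?case using hpath_0[of \<int>]
    by (intro exI[of _ 0]) (simp add: zero_prod_def)
next
  case (Suc M)
  have "0 \<le> real M * a" "real M * a \<le> real (Suc M) * a"
    using assms(2) by (auto intro: mult_right_mono)
  from hpath_cut_UNIV[OF Suc.prems this] obtain g1 g2 where g: "(x, y, z) = g1 \<odot> g2" "hpath UNIV (real M * a) g1" "hpath UNIV (real (Suc M) * a - real M * a) g2"
    by blast
  obtain x1 y1 z1 where g1: "g1 = (x1, y1, z1)" by (cases g1)
  obtain p q r where g2: "g2 = (p, q, r)" by (cases g2)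
  have pa: "hpath UNIV a (p, q, r)" using g(3) by (simp add: g2 algebra_simps)
  note b2 = hpath_bounds[OF pa]
  note b1 = hpath_bounds[OF g(2)[unfolded g1]]
  obtain x' y' z' c where IH: "hpath \<int> c (x', y', z')" "c \<le> real M * a" "\<bar>x1 - x'\<bar> \<le> real M"
    "\<bar>y1 - y'\<bar> \<le> real M" "\<bar>z1 - z'\<bar> \<le> 2 * real M * a\<^sup>2 + 2 * (real M)\<^sup>2 * a"
    using Suc.IH[OF g(2)[unfolded g1]] by blast
  \<comment> \<open>Rounding is towards zero, so no displacement gets longer and the integral path
    is no longer than the real one.\<close>
  obtain p' where p': "p' \<in> \<int>" "\<bar>p'\<bar> \<le> \<bar>p\<bar>" "\<bar>p - p'\<bar> \<le> 1" by (rule truncate_exists)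
  obtain q' where q': "q' \<in> \<int>" "\<bar>q'\<bar> \<le> \<bar>q\<bar>" "\<bar>q - q'\<bar> \<le> 1" by (rule truncate_exists)
  have path: "hpath \<int> (c + (\<bar>p'\<bar> + \<bar>q'\<bar>)) ((x', y', z') \<odot> (p', q', p' * q' / 2))"
    using IH(1) p'(1) q'(1) by (intro hpath_append hpath_corner) auto
  have "\<bar>p'\<bar> \<le> a" "\<bar>q'\<bar> \<le> a" using p' q' b2 by linarith+
  then have pq: "\<bar>p' * q'\<bar> \<le> a\<^sup>2"
    unfolding power2_eq_square abs_mult by (intro mult_mono) auto
  have "\<bar>x1 * q - x' * q'\<bar> \<le> \<bar>x1\<bar> + real M * \<bar>q'\<bar>" "\<bar>y1 * p - y' * p'\<bar> \<le> \<bar>y1\<bar> + real M * \<bar>p'\<bar>"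
    using IH p' q' by (intro abs_mult_diff_le; simp)+
  moreover have "real M * (\<bar>p'\<bar> + \<bar>q'\<bar>) \<le> real M * a"
    using p' q' b2 by (intro mult_left_mono) auto
  ultimately have area: "\<bar>(x1 * q - x' * q') - (y1 * p - y' * p')\<bar> \<le> 2 * (real M * a)"
    using b1 unfolding distrib_left by linarith
  have z: "z = z1 + r + (x1 * q - y1 * p) / 2" and xy: "x = x1 + p" "y = y1 + q"
    using g(1) by (auto simp: g1 g2)
  \<comment> \<open>The terms are the inherited error, the area \<open>r\<close> of the discarded
    piece, the area of the new corner, and half the error of the mixed products.\<close>
  have "\<bar>z - (z' + p' * q' / 2 + (x' * q' - y' * p') / 2)\<bar> \<le>
      2 * real M * a\<^sup>2 + 2 * (real M)\<^sup>2 * a + a\<^sup>2 + a\<^sup>2 / 2 + real M * a"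
    using IH(5) b2(2) pq area unfolding z by (simp add: field_simps)
  also have "\<dots> \<le> 2 * real (Suc M) * a\<^sup>2 + 2 * (real (Suc M))\<^sup>2 * a"
    using assms(2) by (simp add: power2_eq_square algebra_simps)
  finally have "\<bar>z - (z' + p' * q' / 2 + (x' * q' - y' * p') / 2)\<bar> \<le> \<dots>" .
  moreover have "c + (\<bar>p'\<bar> + \<bar>q'\<bar>) \<le> real (Suc M) * a"
    using IH(2) p' q' b2 by (simp add: algebra_simps)
  moreover have "\<bar>x - (x' + p')\<bar> \<le> real (Suc M)" "\<bar>y - (y' + q')\<bar> \<le> real (Suc M)"
    using IH(3,4) p'(3) q'(3) unfolding xy of_nat_Suc by linarith+
  ultimately show ?case using path unfolding hmult_simp by blast
qed

text \<open>The truncated path misses \<open>g\<close> by a bounded horizontal distance and by an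
  area whose quadratic term has a small coefficient. Repairing the area costs a multiple of its
  square root, hence a small multiple of \<open>c\<close> plus a constant.\<close>

lemma hpath_Ints_approx:
  assumes "\<epsilon> > 0"
  obtains K where "0 \<le> K"
    "\<And>c e g. hpath UNIV c g \<Longrightarrow> hpath \<int> e g \<Longrightarrow> \<exists>c'. hpath \<int> c' g \<and> c' \<le> (1 + \<epsilon>) * c + K"
proof -
  \<comment> \<open>This makes the leading area defect \<open>2 * C\<^sup>2 / real M\<close> at most
    \<open>(\<epsilon> / 8 * C)\<^sup>2\<close>; its root enters with the factor 8 and so costs
    \<open>\<epsilon> * C\<close>.\<close>
  obtain M0 :: nat where M0: "real M0 \<ge> 128 / \<epsilon>\<^sup>2" using real_arch_simple by blast
  define M where "M = Suc M0"
  have M: "real M \<ge> 128 / \<epsilon>\<^sup>2" "real M \<ge> 1" using M0 by (auto simp: M_def)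
  \<comment> \<open>With this \<open>K'\<close> the square
    \<open>(\<epsilon> / 8 * C + K')\<^sup>2\<close> also covers the lower-order terms: the summand
    \<open>12 * real M / \<epsilon>\<close> makes the cross term at least
    \<open>3 * real M * C\<close>, and \<open>real M\<close> makes \<open>K'\<^sup>2\<close> at
    least \<open>(real M)\<^sup>2\<close>.\<close>
  define K' where "K' = 12 * real M / \<epsilon> + real M"
  define K where "K = (1 + \<epsilon>) * real M + 2 * real M + 2 + 8 * K'"
  have K'0: "K' \<ge> 0" using assms by (simp add: K'_def)
  then have K0: "K \<ge> 0" using assms by (simp add: K_def)
  have main: "\<exists>c'. hpath \<int> c' g \<and> c' \<le> (1 + \<epsilon>) * c + K" if "hpath UNIV c g" "hpath \<int> e g" for c e g
  proof -
    define C where "C = c + real M"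
    have c0: "c \<ge> 0" using hpath_nonneg[OF that(1)] .
    then have C0: "C \<ge> 0" by (simp add: C_def)
    obtain x y z where g: "g = (x, y, z)" by (cases g)
    have "hpath UNIV (real M * (C / real M)) (x, y, z)"
      using hpath_pad[OF that(1), of C] M by (simp add: g C_def)
    from hpath_truncate[OF this] obtain x' y' z' d where d: "hpath \<int> d (x', y', z')" "d \<le> C"
      "\<bar>x - x'\<bar> \<le> real M" "\<bar>y - y'\<bar> \<le> real M"
      "\<bar>z - z'\<bar> \<le> 2 * real M * (C / real M)\<^sup>2 + 2 * (real M)\<^sup>2 * (C / real M)"
      using C0 M by auto
    have "\<bar>z - z'\<bar> \<le> 2 * C\<^sup>2 / real M + 2 * real M * C"
      using d(5) M by (simp add: power2_eq_square)
    note dz = this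
    define k where "k = z - z' + (y' * x - x' * y) / 2"
    define D where "D = k - (x - x') * (y - y') / 2"
    \<comment> \<open>The length of this path does not matter; its existence shows that the
      correction lies in the lattice.\<close>
    have path: "hpath \<int> (d + e) (- (x', y', z') \<odot> g)"
      by (intro hpath_append hpath_minus d(1) that(2)) auto
    have gg: "- (x', y', z') \<odot> g = (x - x', y - y', k)" by (simp add: g k_def field_simps)
    obtain f where f: "f \<le> \<bar>x - x'\<bar> + \<bar>y - y'\<bar> + 8 * sqrt \<bar>D\<bar> + 2" "hpath \<int> f (x - x', y - y', k)"
      unfolding D_def using hpath_Ints_exists[OF hpath_Ints_lattice[OF path[unfolded gg]]] .
    have xy: "\<bar>x\<bar> + \<bar>y\<bar> \<le> C" using hpath_bounds[OF that(1)[unfolded g]] M by (simp add: C_def)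
    \<comment> \<open>Passing to differences leaves a bound linear in \<open>C\<close>, where
      bounding the two products separately would give a quadratic one.\<close>
    have "y' * x - x' * y = (x - x') * y - (y - y') * x" by (simp add: algebra_simps)
    then have "\<bar>y' * x - x' * y\<bar> \<le> \<bar>x - x'\<bar> * \<bar>y\<bar> + \<bar>y - y'\<bar> * \<bar>x\<bar>"
      using abs_triangle_ineq4[of "(x - x') * y" "(y - y') * x"] by (simp add: abs_mult)
    also have "\<dots> \<le> real M * \<bar>y\<bar> + real M * \<bar>x\<bar>"
      using d by (intro add_mono mult_right_mono) auto
    also have "\<dots> \<le> real M * C"
      using mult_left_mono[OF xy, of "real M"] by (simp add: algebra_simps)
    finally have A: "\<bar>y' * x - x' * y\<bar> \<le> real M * C" .
    have B: "\<bar>(x - x') * (y - y')\<bar> \<le> (real M)\<^sup>2"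
      unfolding power2_eq_square abs_mult using d by (intro mult_mono) auto
    have "\<bar>D\<bar> \<le> 2 * C\<^sup>2 / real M + 3 * real M * C + (real M)\<^sup>2"
      using A B dz unfolding D_def k_def by (simp add: field_simps)
    also have "\<dots> \<le> (\<epsilon> / 8 * C + K')\<^sup>2"
    proof -
      have "128 \<le> real M * \<epsilon>\<^sup>2" using M(1) assms by (simp add: field_simps)
      then have "128 * C\<^sup>2 \<le> real M * \<epsilon>\<^sup>2 * C\<^sup>2" by (intro mult_right_mono) auto
      then have 1: "2 * C\<^sup>2 / real M \<le> (\<epsilon> / 8 * C)\<^sup>2"
        using M(2) by (simp add: field_simps power2_eq_square)
      have "3 * real M \<le> \<epsilon> / 4 * K'" using assms M by (simp add: K'_def field_simps)
      from mult_right_mono[OF this C0] have 2: "3 * real M * C \<le> \<epsilon> / 4 * K' * C" .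
      have 3: "(real M)\<^sup>2 \<le> K'\<^sup>2" using assms by (intro power_mono) (auto simp: K'_def)
      show ?thesis using 1 2 3 by (simp add: power2_sum algebra_simps)
    qed
    finally have "sqrt \<bar>D\<bar> \<le> \<epsilon> / 8 * C + K'"
      using assms C0 K'0 by (intro real_le_lsqrt) auto
    then have "8 * sqrt \<bar>D\<bar> \<le> \<epsilon> * c + \<epsilon> * real M + 8 * K'"
      by (simp add: C_def field_simps)
    then have "d + f \<le> (1 + \<epsilon>) * c + K"
      using f(1) d(2-4) unfolding K_def C_def distrib_right mult_1 by linarith
    moreover have "hpath \<int> (d + f) g"
      using hpath_append[OF d(1) f(2)] by (simp only: gg[symmetric] hmult_minus_cancel)
    ultimately show ?thesis by blast
  qed
  show ?thesis by (rule that[OF K0 main])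
qed

section \<open>Words and horizontal paths\<close>

interpretation GZ: group GZ by (rule group_GZ)

lemma GZ_mult: "(v, g) \<otimes>\<^bsub>GZ\<^esub> (w, h) = (v + w, g \<odot> h)"
  by (simp add: GZ_def heisenberg_int_def integer_group_def)

text \<open>Products of generators concatenate paths; conversely \<open>hpath_unit\<close> breaks an
  integral path into generators, their inverses and trivial steps.\<close>

lemma mem_carrier_GZ: "(v, g) \<in> carrier GZ \<longleftrightarrow> (\<exists>c. hpath \<int> c g)"
proof -
  have "\<exists>c. hpath \<int> c g" if "g \<in> generate heisenberg_real {(1, 0, 0), (0, 1, 0)}"
    using that
  proof (induction rule: generate.induct)
    case one show ?case using hpath_0[of \<int>] by (auto simp: heisenberg_real_def zero_prod_def)
  next
    case (incl h)
    then show ?case using hpath_letter[of 1 \<int> 0] hpath_letter[of 0 \<int> 1] by auto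
  next
    case (inv h)
    then show ?case using hpath_letter[of "- 1" \<int> 0] hpath_letter[of 0 \<int> "- 1"]
      by (auto simp: inv_heisenberg_real)
  next
    case (eng h1 h2) then show ?case using hpath_append by blast
  qed
  moreover have "g \<in> generate heisenberg_real {(1, 0, 0), (0, 1, 0)}" if "hpath {- 1, 0, 1} c g" for c
    using that
  proof (induction rule: hpath.induct)
    case hpath_0
    show ?case using generate.one[of heisenberg_real] by (simp add: heisenberg_real_def zero_prod_def)
  next
    case (hpath_step c g s t)
    let ?A = "{(1, 0, 0), (0, 1, 0)} :: (real \<times> real \<times> real) set"
    have "(1, 0, 0) \<in> generate heisenberg_real ?A" "(0, 1, 0) \<in> generate heisenberg_real ?A"
      "(- 1, 0, 0) \<in> generate heisenberg_real ?A" "(0, - 1, 0) \<in> generate heisenberg_real ?A"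
      "(0, 0, 0) \<in> generate heisenberg_real ?A"
      using generate.inv[of "(1, 0, 0)" ?A heisenberg_real] generate.inv[of "(0, 1, 0)" ?A heisenberg_real]
        generate.one[of heisenberg_real ?A]
      by (auto intro: generate.incl simp: inv_heisenberg_real) (simp add: heisenberg_real_def)
    then have "(s, t, 0) \<in> generate heisenberg_real ?A" using hpath_step.hyps by auto
    with hpath_step.IH show ?case by (rule generate.eng)
  qed
  ultimately have "(\<exists>c. hpath \<int> c g) \<longleftrightarrow> g \<in> generate heisenberg_real {(1, 0, 0), (0, 1, 0)}"
    using hpath_unit by blast
  then show ?thesis by (simp add: GZ_def heisenberg_int_def)
qed

lemma S1_subset: "S1 \<subseteq> carrier GZ" and S2_subset: "S2 \<subseteq> carrier GZ"
  by (auto simp: S1_def S2_def symmetrize_def generators_in_GZ)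

lemma inv_GZ_minus: "(v, g) \<in> carrier GZ \<Longrightarrow> inv\<^bsub>GZ\<^esub> (v, g) = (- v, - g)"
  by (cases g) (simp add: inv_GZ)

lemma word_length_le:
  "set ws \<subseteq> S \<Longrightarrow> word_value G ws = g \<Longrightarrow> word_length G S g \<le> length ws"
  unfolding word_length_def by (rule Least_le) auto

lemma word_length_attained:
  assumes "set us \<subseteq> S" "word_value G us = g"
  obtains ws where "set ws \<subseteq> S" "word_value G ws = g" "length ws = word_length G S g"
proof -
  have "\<exists>n ws. set ws \<subseteq> S \<and> length ws = n \<and> word_value G ws = g" using assms by blast
  from LeastI_ex[OF this] show ?thesis using that unfolding word_length_def by blast
qed

abbreviation XY_letters :: "(int \<times> real \<times> real \<times> real) set" where
  "XY_letters \<equiv> {(0, 1, 0, 0), (0, - 1, 0, 0), (0, 0, 1, 0), (0, 0, - 1, 0)}"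

lemma XY_letters_subset: "XY_letters \<subseteq> S1" "XY_letters \<subseteq> S2" "XY_letters \<subseteq> carrier GZ"
  using S2_subset by (auto simp: S1_eq S2_eq)

lemma word_of_unit_hpath:
  assumes "hpath {- 1, 0, 1} c g"
  shows "\<exists>ws. set ws \<subseteq> XY_letters \<and> real (length ws) = c \<and> word_value GZ ws = (0, g)"
  using assms
proof (induction rule: hpath.induct)
  case hpath_0 show ?case by (rule exI[of _ "[]"]) (simp add: one_GZ zero_prod_def)
next
  case (hpath_step c g s t)
  then obtain ws where ws: "set ws \<subseteq> XY_letters" "real (length ws) = c" "word_value GZ ws = (0, g)"
    by blast
  show ?case
  proof (cases "s = 0 \<and> t = 0")
    case True
    then show ?thesis using ws by (cases g) auto
  next
    case False
    then have l: "(0, s, t, 0) \<in> XY_letters" "\<bar>s\<bar> + \<bar>t\<bar> = 1" using hpath_step.hyps by auto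
    have "word_value GZ (ws @ [(0, s, t, 0)]) = word_value GZ ws \<otimes>\<^bsub>GZ\<^esub> word_value GZ [(0, s, t, 0)]"
      using ws(1) l XY_letters_subset(3) by (intro GZ.word_value_append) (auto simp del: insert_subset)
    also have "\<dots> = (0, g \<odot> (s, t, 0))"
      unfolding ws(3) by (cases g) (simp add: one_GZ mult_GZ)
    finally show ?thesis using ws l by (intro exI[of _ "ws @ [(0, s, t, 0)]"]) auto
  qed
qed

text \<open>The prefix \<open>us\<close> handles the first factor and has central Heisenberg part;
  the appended horizontal letters belong to \<open>S1\<close> and \<open>S2\<close> alike.\<close>

lemma word_of_hpath:
  assumes "hpath \<int> c g" "XY_letters \<subseteq> S" "S \<subseteq> carrier GZ" "set us \<subseteq> S" "word_value GZ us = (v, 0, 0, k)"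
  obtains ws where "set ws \<subseteq> S" "real (length ws) = real (length us) + c"
    "word_value GZ ws = (v, (0, 0, k) \<odot> g)"
proof -
  obtain ws where ws: "set ws \<subseteq> XY_letters" "real (length ws) = c" "word_value GZ ws = (0, g)"
    using word_of_unit_hpath[OF hpath_unit[OF assms(1)]] by blast
  have "word_value GZ (us @ ws) = word_value GZ us \<otimes>\<^bsub>GZ\<^esub> word_value GZ ws"
    using ws(1) assms(2-4) by (intro GZ.word_value_append) blast+
  then show ?thesis using ws assms by (intro that[of "us @ ws"]) (auto simp: GZ_mult)
qed

lemma word_value_replicate:
  "word_value GZ (replicate n (\<sigma>, 0, 0, \<zeta>)) = (int n * \<sigma>, 0, 0, real n * \<zeta>)"
  by (induction n) (auto simp: one_GZ mult_GZ algebra_simps)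

text \<open>Each letter of \<open>S2\<close> moves in exactly one factor, so the two costs add
  up.\<close>

lemma hpath_of_word_S2:
  assumes "set ws \<subseteq> S2" "word_value GZ ws = (v, g)"
  shows "\<exists>c. hpath \<int> c g \<and> \<bar>of_int v\<bar> + c \<le> real (length ws)"
  using assms
proof (induction ws arbitrary: v g)
  case Nil
  then show ?case using hpath_0[of \<int>] by (auto simp: one_GZ zero_prod_def)
next
  case (Cons w ws)
  obtain v' g' where vg: "word_value GZ ws = (v', g')" by (rule prod.exhaust)
  from Cons.prems(1) have "set ws \<subseteq> S2" by simp
  from Cons.IH[OF this vg] obtain c where c: "hpath \<int> c g'" "\<bar>of_int v'\<bar> + c \<le> real (length ws)"
    by blast
  obtain \<sigma> l where w: "w = (\<sigma>, l)" by (rule prod.exhaust)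
  have eq: "v = \<sigma> + v'" "g = l \<odot> g'" using Cons.prems(2) by (auto simp: vg w GZ_mult)
  have "\<bar>\<sigma>\<bar> = 1 \<and> l = 0 \<or> \<sigma> = 0 \<and> hpath \<int> 1 l"
    using Cons.prems(1) hpath_letter[of 1 \<int> 0] hpath_letter[of "- 1" \<int> 0]
      hpath_letter[of 0 \<int> 1] hpath_letter[of 0 \<int> "- 1"]
    by (auto simp: w S2_eq zero_prod_def)
  then show ?case
  proof
    assume "\<bar>\<sigma>\<bar> = 1 \<and> l = 0" then show ?thesis using c by (intro exI[of _ c]) (auto simp: eq)
  next
    assume "\<sigma> = 0 \<and> hpath \<int> 1 l"
    then show ?thesis using c hpath_append[of \<int> 1 l c g'] by (intro exI[of _ "1 + c"]) (auto simp: eq)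
  qed
qed

text \<open>In the construction \<open>m\<close> counts the letters with nonzero first coordinate.
  Each moves \<open>v\<close> and the central part by one, so \<open>m\<close> bounds both; the
  remaining \<open>c\<close> letters are horizontal and give \<open>h\<close>, with all central
  parts collected in front.\<close>

lemma hpath_of_word_S1:
  assumes "set ws \<subseteq> S1" "word_value GZ ws = (v, g)"
  shows "\<exists>c h k m. g = (0, 0, k) \<odot> h \<and> hpath \<int> c h \<and> \<bar>k\<bar> \<le> m \<and> \<bar>of_int v\<bar> \<le> m \<and> m + c \<le> real (length ws)"
  using assms
proof (induction ws arbitrary: v g)
  case Nil
  then show ?case using hpath_0[of \<int>]
    by (intro exI[of _ 0]) (auto simp: one_GZ zero_prod_def)
next
  case (Cons w ws)
  obtain v' g' where vg: "word_value GZ ws = (v', g')" by (rule prod.exhaust)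
  from Cons.prems(1) have "set ws \<subseteq> S1" by simp
  from Cons.IH[OF this vg] obtain c h k m where c: "g' = (0, 0, k) \<odot> h" "hpath \<int> c h" "\<bar>k\<bar> \<le> m" "\<bar>of_int v'\<bar> \<le> m"
    "m + c \<le> real (length ws)"
    by blast
  obtain \<sigma> l where w: "w = (\<sigma>, l)" by (rule prod.exhaust)
  have eq: "v = \<sigma> + v'" "g = l \<odot> g'" using Cons.prems(2) by (auto simp: vg w GZ_mult)
  have "\<bar>\<sigma>\<bar> = 1 \<and> (\<exists>\<zeta>. \<bar>\<zeta>\<bar> = 1 \<and> l = (0, 0, \<zeta>)) \<or> \<sigma> = 0 \<and> hpath \<int> 1 l"
    using Cons.prems(1) hpath_letter[of 1 \<int> 0] hpath_letter[of "- 1" \<int> 0]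
      hpath_letter[of 0 \<int> 1] hpath_letter[of 0 \<int> "- 1"]
    by (auto simp: w S1_eq zero_prod_def)
  then show ?case
  proof
    assume "\<bar>\<sigma>\<bar> = 1 \<and> (\<exists>\<zeta>. \<bar>\<zeta>\<bar> = 1 \<and> l = (0, 0, \<zeta>))"
    then obtain \<zeta> where z: "\<bar>\<sigma>\<bar> = 1" "\<bar>\<zeta>\<bar> = 1" "l = (0, 0, \<zeta>)" by blast
    have "g = (0, 0, \<zeta> + k) \<odot> h" by (cases h) (simp add: eq z c)
    moreover have "\<bar>real_of_int \<sigma>\<bar> = 1" using z(1) by linarith
    moreover have "\<bar>\<zeta> + k\<bar> \<le> m + 1" using z(2) c(3) by linarith
    moreover have "\<bar>real_of_int v\<bar> \<le> m + 1"
      using \<open>\<bar>real_of_int \<sigma>\<bar> = 1\<close> c(4) unfolding eq(1) of_int_add by linarith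
    moreover have "m + 1 + c \<le> real (length (w # ws))" using c(5) by simp
    ultimately show ?thesis using c(2) by blast
  next
    assume l: "\<sigma> = 0 \<and> hpath \<int> 1 l"
    have "g = (0, 0, k) \<odot> (l \<odot> h)" by (cases l; cases h) (simp add: eq c field_simps)
    moreover have "hpath \<int> (1 + c) (l \<odot> h)" using l c(2) hpath_append by blast
    moreover have "m + (1 + c) \<le> real (length (w # ws))" using c(5) by simp
    ultimately show ?thesis using c(3,4) l unfolding eq(1) by (metis add_0)
  qed
qed

lemma hmult_zero_triple: "(0, 0, 0) \<odot> g = g"
  by (cases g) simp

lemma word_S2_exists:
  assumes "hpath \<int> c g"
  obtains ws where "set ws \<subseteq> S2" "real (length ws) = \<bar>of_int v\<bar> + c" "word_value GZ ws = (v, g)"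
proof -
  let ?us = "replicate (nat \<bar>v\<bar>) (sgn v, 0, 0, 0) :: (int \<times> real \<times> real \<times> real) list"
  have "set ?us \<subseteq> S2" by (auto simp: S2_eq sgn_if)
  moreover have "word_value GZ ?us = (v, 0, 0, 0)"
    by (simp add: word_value_replicate sgn_if)
  ultimately obtain ws where "set ws \<subseteq> S2" "real (length ws) = real (length ?us) + c"
    "word_value GZ ws = (v, (0, 0, 0) \<odot> g)"
    using word_of_hpath[OF assms XY_letters_subset(2) S2_subset] by blast
  then show ?thesis by (intro that[of ws]) (simp_all add: hmult_zero_triple)
qed

text \<open>Equally many letters with central parts 1 and -1 cancel. For odd \<open>v\<close> one
  letter is left over, and a commutator of length 4 undoes its central part.\<close>

lemma word_S1_exists:
  assumes "hpath \<int> c g"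
  obtains ws where "set ws \<subseteq> S1" "real (length ws) \<le> \<bar>of_int v\<bar> + c + 4" "word_value GZ ws = (v, g)"
proof -
  define n where "n = nat (\<bar>v\<bar> div 2)"
  let ?us = "replicate n (sgn v, 0, 0, 1) @ replicate n (sgn v, 0, 0, - 1) :: (int \<times> real \<times> real \<times> real) list"
  have sgn: "n = 0 \<or> sgn v = 1 \<or> sgn v = - 1" by (cases "v = 0") (auto simp: n_def sgn_if)
  have us: "set ?us \<subseteq> S1"
  proof -
    have "{(1, 0, 0, 1), (1, 0, 0, - 1), (- 1, 0, 0, 1), (- 1, 0, 0, - 1)} \<subseteq> S1" by (simp add: S1_eq)
    then show ?thesis using sgn by (auto simp: set_replicate_conv_if)
  qed
  have val: "word_value GZ ?us = (2 * int n * sgn v, 0, 0, 0)"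
  proof -
    have "word_value GZ ?us = word_value GZ (replicate n (sgn v, 0, 0, 1)) \<otimes>\<^bsub>GZ\<^esub> word_value GZ (replicate n (sgn v, 0, 0, - 1))"
      using us S1_subset by (intro GZ.word_value_append) auto
    then show ?thesis by (simp add: word_value_replicate mult_GZ algebra_simps)
  qed
  show ?thesis
  proof (cases "even v")
    case True
    then have v: "2 * int n * sgn v = v" "2 * int n = \<bar>v\<bar>" by (auto simp: n_def sgn_if)
    obtain ws where "set ws \<subseteq> S1" "real (length ws) = real (length ?us) + c"
      "word_value GZ ws = (v, (0, 0, 0) \<odot> g)"
      using word_of_hpath[OF assms XY_letters_subset(1) S1_subset us val] v by metis
    moreover have "real (length ?us) = \<bar>of_int v\<bar>" using v(2) by simp
    ultimately show ?thesis by (intro that[of ws]) (simp_all add: hmult_zero_triple)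
  next
    case False
    then have v2: "1 + 2 * int n = \<bar>v\<bar>"
      by (subst add.commute) (simp add: n_def odd_two_times_div_two_succ)
    have "sgn v + 2 * int n * sgn v = sgn v * (1 + 2 * int n)" by (simp add: algebra_simps)
    then have v: "sgn v + 2 * int n * sgn v = v" "1 + 2 * int n = \<bar>v\<bar>"
      using v2 mult_sgn_abs[of v] by auto
    have us': "set ((sgn v, 0, 0, 1) # ?us) \<subseteq> S1" 
    proof -
      have "sgn v = 1 \<or> sgn v = - 1" using False by (auto simp: sgn_if)
      then show ?thesis using us by (auto simp: S1_eq)
    qed
    have val': "word_value GZ ((sgn v, 0, 0, 1) # ?us) = (v, 0, 0, 1)"
      using v(1) by (simp only: word_value_simps val mult_GZ) simp
    have "hpath \<int> (4 + c) ((0, 0, - 1) \<odot> g)"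
      using hpath_append[OF hpath_commutator[of 1 \<int> "- 1"] assms] by simp
    then obtain ws where "set ws \<subseteq> S1" "real (length ws) = real (length ((sgn v, 0, 0, 1) # ?us)) + (4 + c)"
      "word_value GZ ws = (v, (0, 0, 1) \<odot> ((0, 0, - 1) \<odot> g))"
      using word_of_hpath[OF _ XY_letters_subset(1) S1_subset us' val'] by metis
    moreover have "real (length ((sgn v, 0, 0, 1) # ?us)) = \<bar>of_int v\<bar>" using v(2) by simp
    moreover have "(0, 0, 1) \<odot> ((0, 0, - 1) \<odot> g) = g" by (cases g) simp
    ultimately show ?thesis by (intro that[of ws]) auto
  qed
qed

lemma word_length_S2_le:
  assumes "hpath \<int> c g"
  shows "real (word_length GZ S2 (v, g)) \<le> \<bar>of_int v\<bar> + c"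
proof -
  obtain ws where ws: "set ws \<subseteq> S2" "real (length ws) \<le> \<bar>of_int v\<bar> + c" "word_value GZ ws = (v, g)"
    using word_S2_exists[OF assms, of v] by (metis order_refl)
  from word_length_le[OF ws(1,3)] ws(2) show ?thesis by linarith
qed

lemma word_length_S1_le:
  assumes "hpath \<int> c g"
  shows "real (word_length GZ S1 (v, g)) \<le> \<bar>of_int v\<bar> + c + 4"
proof -
  obtain ws where ws: "set ws \<subseteq> S1" "real (length ws) \<le> \<bar>of_int v\<bar> + c + 4" "word_value GZ ws = (v, g)"
    using word_S1_exists[OF assms, of v] by (metis order_refl)
  from word_length_le[OF ws(1,3)] ws(2) show ?thesis by linarith
qed

lemma word_length_S2_ge:
  assumes "(v, g) \<in> carrier GZ"
  obtains c where "hpath \<int> c g" "\<bar>of_int v\<bar> + c \<le> real (word_length GZ S2 (v, g))"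
proof -
  obtain e where "hpath \<int> e g" using assms mem_carrier_GZ by blast
  then obtain us where us: "set us \<subseteq> S2" "word_value GZ us = (v, g)" by (rule word_S2_exists)
  obtain ws where "set ws \<subseteq> S2" "word_value GZ ws = (v, g)" "length ws = word_length GZ S2 (v, g)"
    using word_length_attained[OF us] .
  then show ?thesis using hpath_of_word_S2[of ws v g] that by auto
qed

lemma word_length_S1_ge:
  assumes "(v, g) \<in> carrier GZ"
  obtains c h k m where "g = (0, 0, k) \<odot> h" "hpath \<int> c h" "\<bar>k\<bar> \<le> m" "\<bar>of_int v\<bar> \<le> m"
    "m + c \<le> real (word_length GZ S1 (v, g))"
proof -
  obtain e where "hpath \<int> e g" using assms mem_carrier_GZ by blast
  then obtain us where us: "set us \<subseteq> S1" "word_value GZ us = (v, g)" by (rule word_S1_exists)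
  obtain ws where "set ws \<subseteq> S1" "word_value GZ ws = (v, g)" "length ws = word_length GZ S1 (v, g)"
    using word_length_attained[OF us] .
  then show ?thesis using hpath_of_word_S1[of ws v g] that by auto
qed

lemma word_length_S1_central:
  assumes "\<bar>\<sigma>\<bar> = 1" shows "word_length GZ S1 (int n, 0, 0, \<sigma> * real n) \<le> n"
proof -
  have "\<sigma> = 1 \<or> \<sigma> = - 1" using assms by (auto simp: abs_if split: if_splits)
  then have "(1, 0, 0, \<sigma>) \<in> S1" by (auto simp: S1_eq)
  then have "set (replicate n (1, 0, 0, \<sigma>)) \<subseteq> S1" by (auto simp: set_replicate_conv_if simp del: insert_subset)
  moreover have "word_value GZ (replicate n (1, 0, 0, \<sigma>)) = (int n, 0, 0, \<sigma> * real n)"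
    by (simp add: word_value_replicate)
  ultimately show ?thesis using word_length_le[of "replicate n (1, 0, 0, \<sigma>)" S1 GZ] by simp
qed

section \<open>Near-midpoints\<close>

text \<open>The slack \<open>D\<close> absorbs the parity of integer-valued metrics and the additive
  error of a quasi-isometry.\<close>

definition near_midpoints :: "'a set \<Rightarrow> ('a \<Rightarrow> 'a \<Rightarrow> real) \<Rightarrow> 'a \<Rightarrow> 'a \<Rightarrow> real \<Rightarrow> 'a set" where
  "near_midpoints X d x y D = {p \<in> X. 2 * d x p \<le> d x y + 2 * D \<and> 2 * d p y \<le> d x y + 2 * D}"

text \<open>Pull \<open>q\<close> back to a point whose image is within \<open>C\<close> of it; the
  triangle inequality enlarges the slack by at most \<open>3 * C\<close>. Comparing two pull-backs
  costs \<open>C\<close> for each approximation and once more for \<open>f\<close>.\<close>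

lemma near_midpoints_transfer:
  assumes X: "Metric_space X dX" and Y: "Metric_space Y dY"
    and f: "quasi_isometry 1 C X dX Y dY f" and xy: "x \<in> X" "y \<in> X"
    and E: "\<And>a a'. a \<in> near_midpoints X dX x y (D + 3 * C) \<Longrightarrow> a' \<in> near_midpoints X dX x y (D + 3 * C) \<Longrightarrow> dX a a' \<le> E"
    and q: "q \<in> near_midpoints Y dY (f x) (f y) D" "q' \<in> near_midpoints Y dY (f x) (f y) D"
  shows "dY q q' \<le> E + 3 * C"
proof -
  interpret X: Metric_space X dX by (rule X)
  interpret Y: Metric_space Y dY by (rule Y)
  have fY: "f a \<in> Y" if "a \<in> X" for a using f that by (auto simp: quasi_isometry_def)
  have le: "dX a b - C \<le> dY (f a) (f b)" "dY (f a) (f b) \<le> dX a b + C" if "a \<in> X" "b \<in> X" for a b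
    using f that by (auto simp: quasi_isometry_def)
  have C: "0 \<le> C" using le[OF xy] by linarith
  have lift: "\<exists>a\<in>near_midpoints X dX x y (D + 3 * C). dY q (f a) \<le> C"
    if q: "q \<in> near_midpoints Y dY (f x) (f y) D" for q
  proof -
    have qY: "q \<in> Y" using q by (simp add: near_midpoints_def)
    then obtain a where a: "a \<in> X" "dY q (f a) \<le> C" using f by (auto simp: quasi_isometry_def)
    note t = Y.triangle[OF fY[OF xy(1)] qY fY[OF a(1)]] Y.triangle[OF fY[OF a(1)] qY fY[OF xy(2)]]
      Y.commute[of "f a" q] le[OF xy] le[OF xy(1) a(1)] le[OF a(1) xy(2)]
    have "2 * dY (f x) q \<le> dY (f x) (f y) + 2 * D" "2 * dY q (f y) \<le> dY (f x) (f y) + 2 * D"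
      using q by (auto simp: near_midpoints_def)
    with t a C have "a \<in> near_midpoints X dX x y (D + 3 * C)"
      unfolding near_midpoints_def mem_Collect_eq distrib_left by (intro conjI) linarith+
    with a show ?thesis by blast
  qed
  obtain a where a: "a \<in> near_midpoints X dX x y (D + 3 * C)" "dY q (f a) \<le> C" using lift[OF q(1)] by blast
  obtain a' where a': "a' \<in> near_midpoints X dX x y (D + 3 * C)" "dY q' (f a') \<le> C" using lift[OF q(2)] by blast
  have in_XY: "a \<in> X" "a' \<in> X" "q \<in> Y" "q' \<in> Y" using a a' q by (auto simp: near_midpoints_def)
  show ?thesis
    using Y.triangle[OF in_XY(3) fY[OF in_XY(1)] in_XY(4)] Y.triangle[OF fY[OF in_XY(1)] fY[OF in_XY(2)] in_XY(4)]
      Y.commute[of "f a'" q'] le(2)[OF in_XY(1,2)] E[OF a(1) a'(1)] a(2) a'(2) by linarith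
qed

section \<open>Near-midpoints for \<open>rho1\<close>\<close>

lemma word_metric_GZ:
  assumes "(v, g) \<in> carrier GZ" "(w, h) \<in> carrier GZ"
  shows "word_metric GZ S (v, g) (w, h) = real (word_length GZ S (w - v, - g \<odot> h))"
  using assms by (simp add: word_metric_def inv_GZ_minus GZ_mult)

lemma GZ_diff_closed:
  assumes "(v, g) \<in> carrier GZ" "(w, h) \<in> carrier GZ"
  shows "(w - v, - g \<odot> h) \<in> carrier GZ"
  using GZ.m_closed[OF GZ.inv_closed[OF assms(1)] assms(2)] assms(1) by (simp add: inv_GZ_minus GZ_mult)

lemma one_GZ_in: "(0, 0, 0, 0) \<in> carrier GZ"
  using GZ.one_closed by (simp add: one_GZ)

lemma central_in_GZ: "k \<in> \<int> \<Longrightarrow> (v, 0, 0, k) \<in> carrier GZ"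
  using hpath_Ints_central by (metis mem_carrier_GZ)

lemma word_metric_from_one:
  assumes "(v, g) \<in> carrier GZ"
  shows "word_metric GZ S (0, 0, 0, 0) (v, g) = real (word_length GZ S (v, g))"
  using word_metric_GZ[OF one_GZ_in assms] by (cases g) simp

text \<open>A letter changes the first coordinate by at most one, so powers of
  \<open>(1, 0, 0, \<sigma>)\<close> are geodesic.\<close>

lemma rho1_central:
  assumes "\<bar>\<sigma>\<bar> = 1" shows "rho1 (0, 0, 0, 0) (int n, 0, 0, \<sigma> * real n) = real n"
proof -
  have "\<sigma> \<in> \<int>" using assms by (auto simp: abs_if split: if_splits)
  then have "\<sigma> * real n \<in> \<int>" by auto
  note mem = central_in_GZ[OF this, of "int n"]
  obtain c h k m where "(0, 0, \<sigma> * real n) = (0, 0, k) \<odot> h" "hpath \<int> c h" "\<bar>of_int (int n)\<bar> \<le> m"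
    "m + c \<le> real (word_length GZ S1 (int n, 0, 0, \<sigma> * real n))"
    using word_length_S1_ge[OF mem] by metis
  with hpath_nonneg[of \<int> c h] word_length_S1_central[OF assms, of n]
  have "word_length GZ S1 (int n, 0, 0, \<sigma> * real n) = n" by simp
  then show ?thesis using word_metric_from_one[OF mem] by simp
qed

text \<open>The two halves have at most \<open>n + 2 * D\<close> letters, of which at least
  \<open>n\<close> move the first coordinate. So at most \<open>2 * D\<close> letters are
  horizontal, which bounds \<open>x\<close>, \<open>y\<close> and the area they create.\<close>

lemma near_midpoints_rho1_coords:
  assumes \<sigma>: "\<bar>\<sigma>\<bar> = 1"
    and p: "(v, x, y, z) \<in> near_midpoints (carrier GZ) rho1 (0, 0, 0, 0) (int n, 0, 0, \<sigma> * real n) D"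
  shows "\<bar>of_int v - real n / 2\<bar> \<le> D" "\<bar>x\<bar> + \<bar>y\<bar> \<le> 2 * D" "\<bar>z - \<sigma> * real n / 2\<bar> \<le> D + 4 * D\<^sup>2"
proof -
  have "\<sigma> \<in> \<int>" using \<sigma> by (auto simp: abs_if split: if_splits)
  then have "\<sigma> * real n \<in> \<int>" by auto
  note gG = central_in_GZ[OF this, of "int n"]
  have pG: "(v, x, y, z) \<in> carrier GZ" using p by (simp add: near_midpoints_def)
  have p1: "2 * real (word_length GZ S1 (v, x, y, z)) \<le> real n + 2 * D"
    and p2: "2 * real (word_length GZ S1 (int n - v, - (x, y, z) \<odot> (0, 0, \<sigma> * real n))) \<le> real n + 2 * D"
    using p word_metric_from_one[OF pG, of S1] word_metric_GZ[OF pG gG, of S1] rho1_central[OF \<sigma>]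
    by (auto simp: near_midpoints_def)
  obtain c h k m where 1: "(x, y, z) = (0, 0, k) \<odot> h" "hpath \<int> c h" "\<bar>k\<bar> \<le> m" "\<bar>of_int v\<bar> \<le> m"
    "m + c \<le> real (word_length GZ S1 (v, x, y, z))"
    using word_length_S1_ge[OF pG] .
  obtain c' h' k' m' where 2: "- (x, y, z) \<odot> (0, 0, \<sigma> * real n) = (0, 0, k') \<odot> h'" "hpath \<int> c' h'" "\<bar>k'\<bar> \<le> m'"
    "\<bar>of_int (int n - v)\<bar> \<le> m'"
    "m' + c' \<le> real (word_length GZ S1 (int n - v, - (x, y, z) \<odot> (0, 0, \<sigma> * real n)))"
    using word_length_S1_ge[OF GZ_diff_closed[OF pG gG]] .
  have h: "h = (x, y, z - k)" using 1(1) by (cases h) auto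
  have h': "h' = (- x, - y, \<sigma> * real n - z - k')" using 2(1) by (cases h') auto
  have c: "0 \<le> c" "0 \<le> c'" using hpath_nonneg 1(2) 2(2) by auto
  have m: "of_int v \<le> m" "real n - of_int v \<le> m'" using 1(4) 2(4) by (auto simp: abs_le_iff)
  show "\<bar>of_int v - real n / 2\<bar> \<le> D" using m c 1(5) 2(5) p1 p2 by linarith
  have cD: "c \<le> 2 * D" "c' \<le> 2 * D" using m c 1(5) 2(5) p1 p2 by linarith+
  show "\<bar>x\<bar> + \<bar>y\<bar> \<le> 2 * D" using hpath_bounds(1)[OF 1(2)[unfolded h]] cD by linarith
  have "c\<^sup>2 \<le> (2 * D)\<^sup>2" "c'\<^sup>2 \<le> (2 * D)\<^sup>2" using c cD by (intro power_mono; simp)+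
  then have z: "\<bar>z - k\<bar> \<le> 4 * D\<^sup>2" "\<bar>\<sigma> * real n - z - k'\<bar> \<le> 4 * D\<^sup>2"
    using hpath_bounds(2)[OF 1(2)[unfolded h]] hpath_bounds(2)[OF 2(2)[unfolded h']]
    by (auto simp: power_mult_distrib)
  \<comment> \<open>Each central part is at most about \<open>n / 2\<close> in size, yet up to
    bounded areas they add up to \<open>\<sigma> * real n\<close>; this pins \<open>z\<close> from
    both sides.\<close>
  have k: "\<bar>k\<bar> \<le> real n / 2 + D" "\<bar>k'\<bar> \<le> real n / 2 + D" using 1(3,5) 2(3,5) p1 p2 c by linarith+
  show "\<bar>z - \<sigma> * real n / 2\<bar> \<le> D + 4 * D\<^sup>2"
  proof (cases "\<sigma> = 1")
    case True
    then show ?thesis using z k by simp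
  next
    case False
    then have "\<sigma> = - 1" using \<sigma> by (auto simp: abs_if split: if_splits)
    then show ?thesis using z k by simp
  qed
qed

text \<open>All coordinate differences are bounded in terms of \<open>D\<close>, so the bound is
  uniform in \<open>n\<close> and \<open>\<sigma>\<close>, as the final contradiction for large
  \<open>n\<close> requires.\<close>

lemma near_midpoints_rho1_bounded:
  assumes D: "0 \<le> D"
  obtains E where "0 \<le> E" "\<And>n \<sigma> p p'. \<bar>\<sigma>\<bar> = 1 \<Longrightarrow>
    p \<in> near_midpoints (carrier GZ) rho1 (0, 0, 0, 0) (int n, 0, 0, \<sigma> * real n) D \<Longrightarrow>
    p' \<in> near_midpoints (carrier GZ) rho1 (0, 0, 0, 0) (int n, 0, 0, \<sigma> * real n) D \<Longrightarrow> rho1 p p' \<le> E"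
proof (rule that)
  let ?W = "2 * (D + 4 * D\<^sup>2) + 12 * D\<^sup>2"
  \<comment> \<open>The first coordinate costs \<open>2 * D\<close> and the horizontal ones
    \<open>4 * D\<close>; \<open>8 * sqrt ?W + 2\<close> comes from \<open>hpath_Ints_exists\<close>
    and 4 from \<open>word_length_S1_le\<close>.\<close>
  let ?E = "6 * D + 8 * sqrt ?W + 6"
  show "0 \<le> ?E" using D by simp
  fix n \<sigma> p p'
  assume \<sigma>: "\<bar>\<sigma>\<bar> = 1"
    and p: "p \<in> near_midpoints (carrier GZ) rho1 (0, 0, 0, 0) (int n, 0, 0, \<sigma> * real n) D"
    and p': "p' \<in> near_midpoints (carrier GZ) rho1 (0, 0, 0, 0) (int n, 0, 0, \<sigma> * real n) D"
  obtain v x y z where vx: "p = (v, x, y, z)" by (cases p)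
  obtain v' x' y' z' where vx': "p' = (v', x', y', z')" by (cases p')
  note b = near_midpoints_rho1_coords[OF \<sigma> p[unfolded vx]]
  note b' = near_midpoints_rho1_coords[OF \<sigma> p'[unfolded vx']]
  have G: "(v, x, y, z) \<in> carrier GZ" "(v', x', y', z') \<in> carrier GZ"
    using p p' by (auto simp: near_midpoints_def vx vx')
  define d where "d = z' - z + (y * x' - x * y') / 2"
  have diff: "- (x, y, z) \<odot> (x', y', z') = (x' - x, y' - y, d)" by (simp add: d_def field_simps)
  obtain e where e: "hpath \<int> e (x' - x, y' - y, d)"
    using GZ_diff_closed[OF G] unfolding mem_carrier_GZ diff by blast
  have prod: "\<bar>s * t\<bar> \<le> 4 * D\<^sup>2" if "\<bar>s\<bar> \<le> 2 * D" "\<bar>t\<bar> \<le> 2 * D" for s t :: real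
    using mult_mono[OF that] D by (simp add: abs_mult power2_eq_square)
  define e' where "e' = d - (x' - x) * (y' - y) / 2"
  have "e' = (z' - z) + y * x' - (x * y) / 2 - (x' * y') / 2"
    by (simp add: e'_def d_def field_simps)
  moreover have "\<bar>x * y\<bar> \<le> 4 * D\<^sup>2" "\<bar>x' * y'\<bar> \<le> 4 * D\<^sup>2" "\<bar>y * x'\<bar> \<le> 4 * D\<^sup>2"
    using b(2) b'(2) by (intro prod; linarith)+
  ultimately have W: "\<bar>e'\<bar> \<le> ?W"
    using b(3) b'(3) zero_le_power2[of D] unfolding distrib_left by linarith
  obtain c where c: "c \<le> \<bar>x' - x\<bar> + \<bar>y' - y\<bar> + 8 * sqrt \<bar>e'\<bar> + 2"
    "hpath \<int> c (x' - x, y' - y, d)"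
    unfolding e'_def using hpath_Ints_exists[OF hpath_Ints_lattice[OF e]] .
  have "rho1 p p' \<le> \<bar>of_int (v' - v)\<bar> + c + 4"
    unfolding vx vx' word_metric_GZ[OF G] diff by (rule word_length_S1_le[OF c(2)])
  moreover have "\<bar>of_int (v' - v)\<bar> \<le> 2 * D" using b(1) b'(1) by simp
  ultimately show "rho1 p p' \<le> ?E"
    using c(1) real_sqrt_le_mono[OF W] b(2) b'(2) by linarith
qed

section \<open>Word length for \<open>S2\<close> and near-midpoints for \<open>rho2\<close>\<close>

abbreviation int_hlen :: "real \<times> real \<times> real \<Rightarrow> real" where
  "int_hlen g \<equiv> real (word_length GZ S2 (0, g))"

lemma int_hlen_le: "hpath \<int> c g \<Longrightarrow> int_hlen g \<le> c"
  using word_length_S2_le[of c g 0] by simp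

lemma hpath_int_hlen:
  assumes "(v, g) \<in> carrier GZ" shows "hpath \<int> (int_hlen g) g"
proof -
  have "(0, g) \<in> carrier GZ" using assms by (simp add: mem_carrier_GZ)
  then obtain c where "hpath \<int> c g" "c \<le> int_hlen g" using word_length_S2_ge[of 0 g] by auto
  with int_hlen_le show ?thesis by (metis order_antisym)
qed

text \<open>Additivity holds without error terms: \<open>rho2\<close> is an l1 product metric on the
  nose.\<close>

lemma word_length_S2:
  assumes "(v, g) \<in> carrier GZ"
  shows "real (word_length GZ S2 (v, g)) = \<bar>of_int v\<bar> + int_hlen g"
proof (rule antisym)
  show "real (word_length GZ S2 (v, g)) \<le> \<bar>of_int v\<bar> + int_hlen g"
    by (rule word_length_S2_le[OF hpath_int_hlen[OF assms]])
  obtain c where "hpath \<int> c g" "\<bar>of_int v\<bar> + c \<le> real (word_length GZ S2 (v, g))"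
    using word_length_S2_ge[OF assms] .
  then show "\<bar>of_int v\<bar> + int_hlen g \<le> real (word_length GZ S2 (v, g))"
    using int_hlen_le by fastforce
qed

lemma rho2_eq:
  assumes "(v, g) \<in> carrier GZ" "(w, h) \<in> carrier GZ"
  shows "rho2 (v, g) (w, h) = \<bar>of_int (w - v)\<bar> + int_hlen (- g \<odot> h)"
  unfolding word_metric_GZ[OF assms] word_length_S2[OF GZ_diff_closed[OF assms]] by simp

lemma int_hlen_hmult:
  assumes "(v, g) \<in> carrier GZ" "(w, h) \<in> carrier GZ"
  shows "int_hlen (g \<odot> h) \<le> int_hlen g + int_hlen h"
  by (intro int_hlen_le hpath_append hpath_int_hlen[OF assms(1)] hpath_int_hlen[OF assms(2)])

lemma int_hlen_minus:
  assumes "(v, g) \<in> carrier GZ" shows "int_hlen (- g) \<le> int_hlen g"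
  by (intro int_hlen_le hpath_minus hpath_int_hlen[OF assms]) auto

lemma hpath_cut_Ints:
  assumes "hpath \<int> c g" "0 \<le> i" "of_int i \<le> c"
  shows "\<exists>g1 g2. g = g1 \<odot> g2 \<and> hpath \<int> (of_int i) g1 \<and> hpath \<int> (c - of_int i) g2"
proof -
  have "0 \<le> real_of_int i" using assms(2) by simp
  from hpath_cut[OF assms(1) Ints_0 Ints_diff Ints_of_int this assms(3)] show ?thesis by blast
qed

lemma mem_hmult:
  assumes "(w, b) \<in> carrier GZ" "hpath \<int> c u" shows "(v, b \<odot> u) \<in> carrier GZ"
  using assms hpath_append unfolding mem_carrier_GZ by blast

text \<open>In the \<open>\<ell>\<^sup>1\<close> product one may spend the two factors in either order.\<close>

lemma near_midpoints_rho2_product: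
  assumes o: "(w, b) \<in> carrier GZ" and vh: "(v, h) \<in> carrier GZ" and D: "1 \<le> D"
    and E: "\<And>p p'. p \<in> near_midpoints (carrier GZ) rho2 (w, b) (w + v, b \<odot> h) D \<Longrightarrow>
      p' \<in> near_midpoints (carrier GZ) rho2 (w, b) (w + v, b \<odot> h) D \<Longrightarrow> rho2 p p' \<le> E"
  shows "\<bar>of_int v\<bar> \<le> E \<or> int_hlen h \<le> E"
proof -
  define l where "l = int (word_length GZ S2 (0, h))"
  have l: "of_int l = int_hlen h" "0 \<le> l" by (auto simp: l_def)
  have path: "hpath \<int> (of_int l) h" using hpath_int_hlen[OF vh] l by simp
  \<comment> \<open>Half the distance, rounded down; the slack \<open>D \<ge> 1\<close> pays for the
    rounding.\<close>
  define M where "M = (\<bar>v\<bar> + l) div 2"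
  have M: "2 * M \<le> \<bar>v\<bar> + l" "\<bar>v\<bar> + l \<le> 2 * M + 1" by (auto simp: M_def)
  then have Mr: "2 * real_of_int M \<le> \<bar>of_int v\<bar> + of_int l" "\<bar>of_int v\<bar> + of_int l \<le> 2 * real_of_int M + 1"
    by linarith+
  have q: "(w + v, b \<odot> h) \<in> carrier GZ" by (rule mem_hmult[OF o path])
  have N: "rho2 (w, b) (w + v, b \<odot> h) = \<bar>of_int v\<bar> + of_int l" by (simp add: rho2_eq[OF o q] l)
  have mid: "(w + s, b \<odot> u1) \<in> near_midpoints (carrier GZ) rho2 (w, b) (w + v, b \<odot> h) D"
    if u: "h = u1 \<odot> u2" "hpath \<int> c1 u1" "hpath \<int> c2 u2"
      and le: "\<bar>of_int s\<bar> + c1 \<le> of_int M" "\<bar>of_int (v - s)\<bar> + c2 \<le> of_int M + 1" for s c1 c2 u1 u2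
  proof -
    have m: "(w + s, b \<odot> u1) \<in> carrier GZ" by (rule mem_hmult[OF o u(2)])
    have "- (b \<odot> u1) \<odot> (b \<odot> h) = u2" by (simp add: minus_hmult hmult_assoc u(1))
    then have "rho2 (w, b) (w + s, b \<odot> u1) = \<bar>of_int s\<bar> + int_hlen u1"
      "rho2 (w + s, b \<odot> u1) (w + v, b \<odot> h) = \<bar>of_int (v - s)\<bar> + int_hlen u2"
      by (simp_all add: rho2_eq[OF o m] rho2_eq[OF m q])
    then show ?thesis
      unfolding near_midpoints_def mem_Collect_eq N
      using m le int_hlen_le[OF u(2)] int_hlen_le[OF u(3)] Mr D by (intro conjI) linarith+
  qed
  have d: "rho2 (w + s, b \<odot> u) (w + s', b \<odot> u') = \<bar>of_int (s' - s)\<bar> + int_hlen (- u \<odot> u')"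
    if "hpath \<int> c u" "hpath \<int> c' u'" for s s' u u' c c'
    by (simp add: rho2_eq[OF mem_hmult[OF o that(1)] mem_hmult[OF o that(2)]] minus_hmult hmult_assoc)
  show ?thesis
  proof (cases "l \<le> \<bar>v\<bar>")
    case True
    \<comment> \<open>One point spends its whole half on the first factor, the other first traverses
      all of \<open>h\<close>; they differ by \<open>h\<close> in the Heisenberg factor.\<close>
    have "\<bar>of_int (sgn v * M)\<bar> \<le> real_of_int M" "\<bar>of_int (v - sgn v * M)\<bar> + real_of_int l \<le> of_int M + 1"
      "\<bar>of_int (sgn v * (M - l))\<bar> + real_of_int l \<le> of_int M" "\<bar>of_int (v - sgn v * (M - l))\<bar> \<le> real_of_int M + 1"
      using True M l(2) by (auto simp: sgn_if abs_if)
    with mid[of 0 h 0 "of_int l" "sgn v * M"] mid[of h 0 "of_int l" 0 "sgn v * (M - l)"] path hpath_0[of \<int>]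
    have "rho2 (w + sgn v * M, b \<odot> 0) (w + sgn v * (M - l), b \<odot> h) \<le> E" by (intro E) auto
    then show ?thesis using d[OF hpath_0 path, of "sgn v * M" "sgn v * (M - l)"] l by auto
  next
    case False
    then have lv: "\<bar>v\<bar> \<le> l" "0 \<le> M" "0 \<le> M - \<bar>v\<bar>" "M \<le> l" "M - \<bar>v\<bar> \<le> l" using M by auto
    then have lvr: "real_of_int M \<le> of_int l" "of_int (M - \<bar>v\<bar>) \<le> real_of_int l" by auto
    \<comment> \<open>Now \<open>h\<close> is the longer part. Both points lie along a geodesic of
      \<open>h\<close>, one before and one after all of \<open>v\<close> is spent, so they differ by
      \<open>v\<close> in the first factor.\<close>
    obtain u1 u2 where u: "h = u1 \<odot> u2" "hpath \<int> (of_int M) u1" "hpath \<int> (of_int l - of_int M) u2"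
      using hpath_cut_Ints[OF path lv(2) lvr(1)] by blast
    obtain t1 t2 where t: "h = t1 \<odot> t2" "hpath \<int> (of_int (M - \<bar>v\<bar>)) t1" "hpath \<int> (of_int l - of_int (M - \<bar>v\<bar>)) t2"
      using hpath_cut_Ints[OF path lv(3) lvr(2)] by blast
    have "rho2 (w + 0, b \<odot> u1) (w + v, b \<odot> t1) \<le> E"
      using mid[OF u, of 0] mid[OF t, of v] Mr by (intro E) auto
    then show ?thesis using d[OF u(2) t(2), of 0 v] by auto
  qed
qed

text \<open>The horizontal coordinates change by at most one per letter, so the path either hits the
  level \<open>L\<close> exactly or stays strictly inside the box; inside it, each letter adds at
  most \<open>L\<close> to the area.\<close>

lemma hpath_reach:
  assumes "hpath {- 1, 0, 1} c g" "1 \<le> L"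
  shows "(\<exists>s t i. g = s \<odot> t \<and> hpath \<int> i s \<and> hpath \<int> (c - i) t \<and>
        (\<bar>fst s\<bar> = real L \<or> \<bar>fst (snd s)\<bar> = real L)) \<or>
    \<bar>fst g\<bar> \<le> real L - 1 \<and> \<bar>fst (snd g)\<bar> \<le> real L - 1 \<and> \<bar>snd (snd g)\<bar> \<le> real L * c"
  using assms(1)
proof (induction rule: hpath.induct)
  case hpath_0 then show ?case using assms(2) by simp
next
  case (hpath_step c g a b)
  have sub: "{- 1, 0, 1} \<subseteq> (\<int> :: real set)" by auto
  have ab: "a \<in> \<int>" "b \<in> \<int>" using hpath_step.hyps sub by blast+
  have path: "hpath \<int> c g" using hpath_mono[OF hpath_step.hyps(1) sub] .
  have letter: "hpath \<int> (\<bar>a\<bar> + \<bar>b\<bar>) (a, b, 0)" using ab hpath_step.hyps(4) by (rule hpath_letter)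
  from hpath_step.IH show ?case
  proof
    assume "\<exists>s t i. g = s \<odot> t \<and> hpath \<int> i s \<and> hpath \<int> (c - i) t \<and> (\<bar>fst s\<bar> = real L \<or> \<bar>fst (snd s)\<bar> = real L)"
    then obtain s t i where s: "g = s \<odot> t" "hpath \<int> i s" "hpath \<int> (c - i) t"
      "\<bar>fst s\<bar> = real L \<or> \<bar>fst (snd s)\<bar> = real L" by blast
    have "hpath \<int> (c + \<bar>a\<bar> + \<bar>b\<bar> - i) (t \<odot> (a, b, 0))"
      using hpath_append[OF s(3) letter] by (simp add: algebra_simps)
    moreover have "g \<odot> (a, b, 0) = s \<odot> (t \<odot> (a, b, 0))" by (simp add: s(1) hmult_assoc)
    ultimately show ?thesis using s(2,4) by blast
  next
    assume small: "\<bar>fst g\<bar> \<le> real L - 1 \<and> \<bar>fst (snd g)\<bar> \<le> real L - 1 \<and> \<bar>snd (snd g)\<bar> \<le> real L * c"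
    obtain x y z where g: "g = (x, y, z)" by (cases g)
    have xy: "x \<in> \<int>" "y \<in> \<int>" using hpath_Ints_lattice path by (auto simp: g)
    have le1: "\<bar>a\<bar> \<le> 1" "\<bar>b\<bar> \<le> 1" using hpath_step.hyps by auto
    have jump: "\<bar>x + a\<bar> = real L \<or> \<bar>x + a\<bar> \<le> real L - 1"
      if Z: "x \<in> \<int>" "a \<in> \<int>" and le: "\<bar>x\<bar> \<le> real L - 1" "\<bar>a\<bar> \<le> 1" for x a :: real
    proof -
      obtain i j where ij: "x = of_int i" "a = of_int j" using Z by (auto elim!: Ints_cases)
      have "\<bar>i\<bar> \<le> int L - 1" "\<bar>j\<bar> \<le> 1" using le unfolding ij by linarith+
      then have "\<bar>i + j\<bar> = int L \<or> \<bar>i + j\<bar> \<le> int L - 1" by linarith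
      then show ?thesis unfolding ij by linarith
    qed
    note j = jump[OF xy(1) ab(1)] jump[OF xy(2) ab(2)]
    have "\<bar>x * b - y * a\<bar> \<le> \<bar>x\<bar> * \<bar>b\<bar> + \<bar>y\<bar> * \<bar>a\<bar>"
      using abs_triangle_ineq4[of "x * b" "y * a"] by (simp add: abs_mult)
    also have "\<dots> \<le> real L * \<bar>b\<bar> + real L * \<bar>a\<bar>" using small by (intro add_mono mult_right_mono) (auto simp: g)
    finally have "\<bar>x * b - y * a\<bar> \<le> real L * \<bar>b\<bar> + real L * \<bar>a\<bar>" .
    moreover have "\<bar>z + (x * b - y * a) / 2\<bar> \<le> \<bar>z\<bar> + \<bar>x * b - y * a\<bar>"
      using abs_triangle_ineq[of z "(x * b - y * a) / 2"] abs_ge_zero[of "x * b - y * a"]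
      unfolding abs_divide by (simp del: abs_ge_zero)
    moreover have "\<bar>z\<bar> \<le> real L * c" using small by (simp add: g)
    ultimately have "\<bar>z + (x * b - y * a) / 2\<bar> \<le> real L * (c + \<bar>a\<bar> + \<bar>b\<bar>)"
      unfolding distrib_left by linarith
    moreover have "\<exists>s t i. g \<odot> (a, b, 0) = s \<odot> t \<and> hpath \<int> i s \<and> hpath \<int> (c + \<bar>a\<bar> + \<bar>b\<bar> - i) t \<and>
        (\<bar>fst s\<bar> = real L \<or> \<bar>fst (snd s)\<bar> = real L)" if "\<bar>x + a\<bar> = real L \<or> \<bar>y + b\<bar> = real L"
    proof -
      have "hpath \<int> (c + \<bar>a\<bar> + \<bar>b\<bar>) (g \<odot> (a, b, 0))" using hpath_append[OF path letter] by (simp add: add.assoc)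
      then show ?thesis using that hpath_0[of \<int>]
        by (intro exI[of _ "g \<odot> (a, b, 0)"] exI[of _ 0] exI[of _ "c + \<bar>a\<bar> + \<bar>b\<bar>"]) (auto simp: g)
    qed
    ultimately show ?thesis using j small le1 by (auto simp: g)
  qed
qed

text \<open>Conjugating by one letter an initial segment whose endpoint has horizontal coordinate
  \<open>\<plusminus>L\<close> multiplies by the central element \<open>(0, 0, \<plusminus>L)\<close> at the price of two letters.\<close>

lemma hpath_shift_central:
  assumes L: "1 \<le> L"
  obtains B where "\<And>w u \<epsilon>. (w, u) \<in> carrier GZ \<Longrightarrow> B \<le> int_hlen u \<Longrightarrow> \<bar>\<epsilon>\<bar> = 1 \<Longrightarrow>
    hpath \<int> (int_hlen u + 2) ((0, 0, \<epsilon> * real L) \<odot> u)"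
proof (rule that)
  fix w u and \<epsilon> :: real
  assume mem: "(w, u) \<in> carrier GZ" and B: "(8 * real L + 10)\<^sup>2 \<le> int_hlen u" and \<epsilon>: "\<bar>\<epsilon>\<bar> = 1"
  let ?c = "int_hlen u"
  have path: "hpath \<int> ?c u" by (rule hpath_int_hlen[OF mem])
  have \<epsilon>Z: "\<epsilon> \<in> \<int>" using \<epsilon> by (auto simp: abs_if split: if_splits)
  from hpath_reach[OF hpath_unit[OF path] L]
  show "hpath \<int> (?c + 2) ((0, 0, \<epsilon> * real L) \<odot> u)"
  proof
    assume "\<exists>s t i. u = s \<odot> t \<and> hpath \<int> i s \<and> hpath \<int> (?c - i) t \<and> (\<bar>fst s\<bar> = real L \<or> \<bar>fst (snd s)\<bar> = real L)"
    then obtain s t i where s: "u = s \<odot> t" "hpath \<int> i s" "hpath \<int> (?c - i) t"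
      "\<bar>fst s\<bar> = real L \<or> \<bar>fst (snd s)\<bar> = real L" by blast
    obtain x y z where xyz: "s = (x, y, z)" by (cases s)
    \<comment> \<open>Conjugation by \<open>(a, 0, 0)\<close> adds \<open>a * y\<close> to the
      central coordinate, conjugation by \<open>(0, b, 0)\<close> adds \<open>- b * x\<close>; this
      dictates the signs of the letters.\<close>
    have "\<exists>a. hpath \<int> 1 a \<and> a \<odot> s \<odot> - a = (0, 0, \<epsilon> * real L) \<odot> s"
    proof (cases "\<bar>y\<bar> = real L")
      case True
      have "\<epsilon> * sgn y \<in> \<int>" "\<bar>\<epsilon> * sgn y\<bar> = 1" using \<epsilon> \<epsilon>Z True L by (auto simp: sgn_if abs_mult)
      then have "hpath \<int> 1 (\<epsilon> * sgn y, 0, 0)" using hpath_letter[of "\<epsilon> * sgn y" \<int> 0] by auto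
      moreover have "sgn y * y = real L" using True by (auto simp: sgn_if)
      then have "(\<epsilon> * sgn y, 0, 0) \<odot> s \<odot> - (\<epsilon> * sgn y, 0, 0) = (0, 0, \<epsilon> * real L) \<odot> s"
        by (simp add: xyz field_simps)
      ultimately show ?thesis by blast
    next
      case False
      then have xL: "\<bar>x\<bar> = real L" using s(4) by (simp add: xyz)
      have "- \<epsilon> * sgn x \<in> \<int>" "\<bar>- \<epsilon> * sgn x\<bar> = 1" using \<epsilon> \<epsilon>Z xL L by (auto simp: sgn_if abs_mult)
      then have "hpath \<int> 1 (0, - \<epsilon> * sgn x, 0)" using hpath_letter[of 0 \<int> "- \<epsilon> * sgn x"] by auto
      moreover have "sgn x * x = real L" using xL by (auto simp: sgn_if)
      then have "(0, - \<epsilon> * sgn x, 0) \<odot> s \<odot> - (0, - \<epsilon> * sgn x, 0) = (0, 0, \<epsilon> * real L) \<odot> s"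
        by (simp add: xyz field_simps)
      ultimately show ?thesis by blast
    qed
    then obtain a where a: "hpath \<int> 1 a" "a \<odot> s \<odot> - a = (0, 0, \<epsilon> * real L) \<odot> s" by blast
    have "hpath \<int> (1 + i + 1 + (?c - i)) (a \<odot> s \<odot> - a \<odot> t)"
      using a(1) s(2,3) by (intro hpath_append hpath_minus) auto
    then show ?thesis unfolding a(2) s(1) by (simp add: hmult_assoc add_ac)
  next
    \<comment> \<open>Here the central coordinate is at most \<open>real L * ?c\<close>, so
      \<open>u\<close> has a path of length of order \<open>real L * sqrt ?c\<close>. Above the
      threshold \<open>(8 * real L + 10)\<^sup>2\<close> this is shorter than the geodesic, which is
      absurd.\<close>
    assume small: "\<bar>fst u\<bar> \<le> real L - 1 \<and> \<bar>fst (snd u)\<bar> \<le> real L - 1 \<and> \<bar>snd (snd u)\<bar> \<le> real L * ?c"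
    obtain x y z where u: "u = (x, y, z)" by (cases u)
    obtain d where d: "d \<le> \<bar>x\<bar> + \<bar>y\<bar> + 8 * sqrt \<bar>z - x * y / 2\<bar> + 2" "hpath \<int> d (x, y, z)"
      using hpath_Ints_exists[OF hpath_Ints_lattice[OF path[unfolded u]]] .
    define r where "r = sqrt (?c + 1)"
    have r2: "r * r = ?c + 1" by (simp add: r_def)
    have "\<bar>x * y\<bar> \<le> real L * real L" unfolding abs_mult using small by (intro mult_mono) (auto simp: u)
    then have "\<bar>z - x * y / 2\<bar> \<le> real L * ?c + real L * real L" 
    proof -
      have "\<bar>z\<bar> \<le> real L * ?c" using small by (simp add: u)
      with \<open>\<bar>x * y\<bar> \<le> real L * real L\<close> show ?thesis by linarith
    qed
    also have "\<dots> \<le> (real L)\<^sup>2 * (?c + 1)"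
      using mult_right_mono[of 1 "real L" "real L * ?c"] L by (simp add: power2_eq_square algebra_simps)
    finally have "sqrt \<bar>z - x * y / 2\<bar> \<le> sqrt ((real L)\<^sup>2 * (?c + 1))" by (rule real_sqrt_le_mono)
    also have "\<dots> = real L * r" by (simp add: real_sqrt_mult r_def)
    finally have "?c \<le> 2 * real L + 8 * (real L * r)"
      using int_hlen_le[OF d(2)] d(1) small by (simp add: u)
    moreover have "8 * real L + 10 \<le> r" unfolding r_def using B by (intro real_le_rsqrt) simp
    moreover from this have "(8 * real L + 10) * r \<le> r * r"
      by (intro mult_right_mono) auto
    then have "8 * (real L * r) + 10 * r \<le> ?c + 1" using r2 by (simp add: algebra_simps)
    ultimately have False by linarith
    then show ?thesis ..
  qed
qed

lemma int_hlen_central_ge: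
  assumes "k \<in> \<int>" shows "sqrt \<bar>k\<bar> \<le> int_hlen (0, 0, k)"
  using hpath_bounds(2)[OF hpath_int_hlen[OF central_in_GZ[OF assms]]]
  by (intro real_le_lsqrt) auto

text \<open>Cut a geodesic of a long \<open>h\<close> in the middle and shift the two halves by
  opposite central elements, which leaves \<open>h\<close> unchanged. Each half grows by at most two
  letters, so the midpoint and its central translate are both near-midpoints, at distance at least
  \<open>sqrt (real L) > E\<close>.\<close>

lemma near_midpoints_rho2_heisenberg:
  assumes "0 \<le> A" "0 \<le> E"
  obtains B where "\<And>w b v h. (w, b) \<in> carrier GZ \<Longrightarrow> (v, h) \<in> carrier GZ \<Longrightarrow> \<bar>of_int v\<bar> \<le> A \<Longrightarrow>
    (\<And>p p'. p \<in> near_midpoints (carrier GZ) rho2 (w, b) (w + v, b \<odot> h) (A + 4) \<Longrightarrow>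
      p' \<in> near_midpoints (carrier GZ) rho2 (w, b) (w + v, b \<odot> h) (A + 4) \<Longrightarrow> rho2 p p' \<le> E) \<Longrightarrow>
    int_hlen h \<le> B"
proof -
  obtain L0 :: nat where L0: "E\<^sup>2 < real L0" using reals_Archimedean2 by blast
  define L where "L = Suc L0"
  have L: "1 \<le> L" "E\<^sup>2 < real L" using L0 by (auto simp: L_def)
  obtain B where B: "\<And>w u \<epsilon>. (w, u) \<in> carrier GZ \<Longrightarrow> B \<le> int_hlen u \<Longrightarrow> \<bar>\<epsilon>\<bar> = 1 \<Longrightarrow>
    hpath \<int> (int_hlen u + 2) ((0, 0, \<epsilon> * real L) \<odot> u)"
    using hpath_shift_central[OF L(1)] by blast
  show ?thesis
  proof (rule that, rule ccontr)
    fix w b v h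
    assume o: "(w, b) \<in> carrier GZ" and vh: "(v, h) \<in> carrier GZ" and v: "\<bar>of_int v\<bar> \<le> A"
      and E: "\<And>p p'. p \<in> near_midpoints (carrier GZ) rho2 (w, b) (w + v, b \<odot> h) (A + 4) \<Longrightarrow>
        p' \<in> near_midpoints (carrier GZ) rho2 (w, b) (w + v, b \<odot> h) (A + 4) \<Longrightarrow> rho2 p p' \<le> E"
      and "\<not> int_hlen h \<le> 2 * B + 2"
    define l where "l = int (word_length GZ S2 (0, h))"
    have l: "of_int l = int_hlen h" "0 \<le> l" by (auto simp: l_def)
    have path: "hpath \<int> (of_int l) h" using hpath_int_hlen[OF vh] l by simp
    define M where "M = l div 2"
    have M: "0 \<le> M" "M \<le> l" "2 * M \<le> l" "l \<le> 2 * M + 1" using l(2) by (auto simp: M_def)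
    then have Mr: "real_of_int M \<le> of_int l" "2 * real_of_int M \<le> of_int l" "real_of_int l \<le> 2 * of_int M + 1"
      by linarith+
    obtain u1 u2 where u: "h = u1 \<odot> u2" "hpath \<int> (of_int M) u1" "hpath \<int> (of_int l - of_int M) u2"
      using hpath_cut_Ints[OF path M(1) Mr(1)] by blast
    have G: "(0, u1) \<in> carrier GZ" "(0, u2) \<in> carrier GZ" using u by (auto simp: mem_carrier_GZ)
    \<comment> \<open>Pieces of a geodesic are geodesic.\<close>
    have "of_int l \<le> int_hlen u1 + int_hlen u2" using int_hlen_hmult[OF G] u(1) l by simp
    then have u_len: "int_hlen u1 = of_int M" "int_hlen u2 = of_int l - of_int M"
      using int_hlen_le[OF u(2)] int_hlen_le[OF u(3)] by linarith+
    \<comment> \<open>The excluded bound \<open>2 * B + 2\<close> leaves room for the rounding of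
      \<open>M\<close>.\<close>
    have "B \<le> int_hlen u1" "B \<le> int_hlen u2"
      using \<open>\<not> int_hlen h \<le> 2 * B + 2\<close> Mr unfolding u_len l(1)[symmetric] by linarith+
    then have s1: "hpath \<int> (of_int M + 2) ((0, 0, real L) \<odot> u1)" and s2: "hpath \<int> (of_int l - of_int M + 2) ((0, 0, - real L) \<odot> u2)"
      using B[OF G(1), of 1] B[OF G(2), of "- 1"] by (auto simp: u_len)
    let ?u = "(0, 0, real L) \<odot> u1"
    have q: "(w + v, b \<odot> h) \<in> carrier GZ" by (rule mem_hmult[OF o path])
    have p: "(w, b \<odot> u1) \<in> carrier GZ" "(w, b \<odot> ?u) \<in> carrier GZ"
      using mem_hmult[OF o u(2)] mem_hmult[OF o s1] by auto
    have e1: "- (b \<odot> u1) \<odot> (b \<odot> h) = u2" by (simp add: minus_hmult hmult_assoc u(1))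
    have "- ?u \<odot> h = (0, 0, - real L) \<odot> u2"
      unfolding u(1) by (cases u1; cases u2) (simp add: field_simps)
    then have e2: "- (b \<odot> ?u) \<odot> (b \<odot> h) = (0, 0, - real L) \<odot> u2"
      by (simp only: minus_hmult[of b] hmult_assoc hmult_minus_cancel)
    have N: "rho2 (w, b) (w + v, b \<odot> h) = \<bar>of_int v\<bar> + of_int l" by (simp add: rho2_eq[OF o q] l)
    \<comment> \<open>All of \<open>v\<close> is spent in the second half; the slack covers this
      cost of at most \<open>A\<close>, the two additional letters and the rounding.\<close>
    have mid: "(w, b \<odot> u) \<in> near_midpoints (carrier GZ) rho2 (w, b) (w + v, b \<odot> h) (A + 4)"
      if pu: "(w, b \<odot> u) \<in> carrier GZ" and "int_hlen u \<le> of_int M + 2"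
        "int_hlen (- (b \<odot> u) \<odot> (b \<odot> h)) \<le> of_int l - of_int M + 2" for u
    proof -
      have "rho2 (w, b) (w, b \<odot> u) = int_hlen u"
        "rho2 (w, b \<odot> u) (w + v, b \<odot> h) = \<bar>of_int v\<bar> + int_hlen (- (b \<odot> u) \<odot> (b \<odot> h))"
        by (simp_all add: rho2_eq[OF o pu] rho2_eq[OF pu q])
      then show ?thesis
        unfolding near_midpoints_def mem_Collect_eq N distrib_left using that Mr v by (intro conjI) linarith+
    qed
    have "(w, b \<odot> u1) \<in> near_midpoints (carrier GZ) rho2 (w, b) (w + v, b \<odot> h) (A + 4)"
      using p(1) by (rule mid) (simp_all only: e1, simp_all add: u_len)
    moreover have "(w, b \<odot> ?u) \<in> near_midpoints (carrier GZ) rho2 (w, b) (w + v, b \<odot> h) (A + 4)"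
      using p(2) by (rule mid) (simp_all only: e2 int_hlen_le[OF s1] int_hlen_le[OF s2])
    ultimately have "rho2 (w, b \<odot> u1) (w, b \<odot> ?u) \<le> E" by (rule E)
    moreover have "- (b \<odot> u1) \<odot> (b \<odot> ?u) = (0, 0, real L)"
    proof -
      have "- u1 \<odot> ?u = (0, 0, real L)" by (cases u1) (simp add: field_simps)
      then show ?thesis by (simp only: minus_hmult[of b] hmult_assoc hmult_minus_cancel)
    qed
    ultimately have "int_hlen (0, 0, real L) \<le> E" by (simp add: rho2_eq[OF p])
    then have "sqrt (real L) \<le> E" using int_hlen_central_ge[of "real L"] by simp
    moreover have "E < sqrt (real L)" using L(2) by (intro real_less_rsqrt)
    ultimately show False by simp
  qed
qed

section \<open>Nonexistence of a (1, C)-quasi-isometry\<close>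

lemma no_1_C_quasi_isometry: "\<not> quasi_isometric_with 1 C (carrier GZ) rho1 (carrier GZ) rho2"
proof
  assume "quasi_isometric_with 1 C (carrier GZ) rho1 (carrier GZ) rho2"
  then obtain f where f: "quasi_isometry 1 C (carrier GZ) rho1 (carrier GZ) rho2 f"
    by (auto simp: quasi_isometric_with_def)
  note tr = near_midpoints_transfer[OF Metric_space_rho1 Metric_space_rho2 f]
  have fG: "f a \<in> carrier GZ" if "a \<in> carrier GZ" for a using f that by (auto simp: quasi_isometry_def)
  have fd: "rho1 a b - C \<le> rho2 (f a) (f b)" "rho2 (f a) (f b) \<le> rho1 a b + C"
    if "a \<in> carrier GZ" "b \<in> carrier GZ" for a b
    using f that by (auto simp: quasi_isometry_def)
  have C: "0 \<le> C" using fd[OF one_GZ_in one_GZ_in] by linarith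
  let ?e = "(0, 0, 0, 0) :: int \<times> real \<times> real \<times> real"
  let ?g = "\<lambda>n \<sigma>. (int n, 0, 0, \<sigma> * real n) :: int \<times> real \<times> real \<times> real"
  obtain w b where o: "f ?e = (w, b)" by (rule prod.exhaust)
  have oG: "(w, b) \<in> carrier GZ" using fG[OF one_GZ_in] o by simp
  have gG: "?g n \<sigma> \<in> carrier GZ" if "\<bar>\<sigma>\<bar> = 1" for n \<sigma>
    using that by (intro central_in_GZ Ints_mult) (auto simp: abs_if split: if_splits)
  obtain E1 where E1: "0 \<le> E1" "\<And>n \<sigma> p p'. \<bar>\<sigma>\<bar> = 1 \<Longrightarrow>
    p \<in> near_midpoints (carrier GZ) rho1 ?e (?g n \<sigma>) (1 + 3 * C) \<Longrightarrow>
    p' \<in> near_midpoints (carrier GZ) rho1 ?e (?g n \<sigma>) (1 + 3 * C) \<Longrightarrow> rho1 p p' \<le> E1"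
    using near_midpoints_rho1_bounded[of "1 + 3 * C"] C by auto
  \<comment> \<open>The transfer is applied twice: slack 1 shows that one of the components
    \<open>v\<close>, \<open>h\<close> of an image is at most \<open>A\<close>; if it is
    \<open>v\<close>, slack \<open>A + 4\<close> bounds \<open>h\<close> as well.\<close>
  define A where "A = E1 + 3 * C"
  have A: "0 \<le> A" using E1(1) C by (simp add: A_def)
  obtain E2 where E2: "0 \<le> E2" "\<And>n \<sigma> p p'. \<bar>\<sigma>\<bar> = 1 \<Longrightarrow>
    p \<in> near_midpoints (carrier GZ) rho1 ?e (?g n \<sigma>) (A + 4 + 3 * C) \<Longrightarrow>
    p' \<in> near_midpoints (carrier GZ) rho1 ?e (?g n \<sigma>) (A + 4 + 3 * C) \<Longrightarrow> rho1 p p' \<le> E2"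
    using near_midpoints_rho1_bounded[of "A + 4 + 3 * C"] C A by auto
  have E2C: "0 \<le> E2 + 3 * C" using E2(1) C by simp
  obtain B0 where B0: "\<And>w b v h. (w, b) \<in> carrier GZ \<Longrightarrow> (v, h) \<in> carrier GZ \<Longrightarrow> \<bar>of_int v\<bar> \<le> A \<Longrightarrow>
    (\<And>p p'. p \<in> near_midpoints (carrier GZ) rho2 (w, b) (w + v, b \<odot> h) (A + 4) \<Longrightarrow>
      p' \<in> near_midpoints (carrier GZ) rho2 (w, b) (w + v, b \<odot> h) (A + 4) \<Longrightarrow> rho2 p p' \<le> E2 + 3 * C) \<Longrightarrow>
    int_hlen h \<le> B0"
    using near_midpoints_rho2_heisenberg[OF A E2C] by blast
  define B where "B = max A B0"
  \<comment> \<open>Either way the Heisenberg component is bounded independently of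
    \<open>n\<close>, so the first factor carries the distance \<open>n\<close> up to a
    constant.\<close>
  have image: "\<exists>v h. (v, h) \<in> carrier GZ \<and> f (?g n \<sigma>) = (w + v, b \<odot> h) \<and> int_hlen h \<le> B \<and>
      real n - C - B \<le> \<bar>of_int v\<bar> \<and> \<bar>of_int v\<bar> \<le> real n + C" if \<sigma>: "\<bar>\<sigma>\<bar> = 1" for n \<sigma>
  proof -
    obtain w' b' where q: "f (?g n \<sigma>) = (w', b')" by (rule prod.exhaust)
    have qG: "(w', b') \<in> carrier GZ" using fG[OF gG[OF \<sigma>, of n]] q by simp
    define v where "v = w' - w"
    define h where "h = - b \<odot> b'"
    have vh: "(v, h) \<in> carrier GZ" unfolding v_def h_def by (rule GZ_diff_closed[OF oG qG])
    have q': "f (?g n \<sigma>) = (w + v, b \<odot> h)" by (simp add: q v_def h_def)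
    have qG': "(w + v, b \<odot> h) \<in> carrier GZ" using qG q q' by simp
    have "\<bar>of_int v\<bar> \<le> A \<or> int_hlen h \<le> A"
      using tr[OF one_GZ_in gG[OF \<sigma>, of n] E1(2)[OF \<sigma>], unfolded o q']
      unfolding A_def by (rule near_midpoints_rho2_product[OF oG vh order_refl])
    moreover have "int_hlen h \<le> B0" if "\<bar>of_int v\<bar> \<le> A"
      using tr[OF one_GZ_in gG[OF \<sigma>, of n] E2(2)[OF \<sigma>], unfolded o q'] by (rule B0[OF oG vh that])
    ultimately have hB: "int_hlen h \<le> B" unfolding B_def by linarith
    have "rho2 (w, b) (w + v, b \<odot> h) = \<bar>of_int v\<bar> + int_hlen h" by (simp add: rho2_eq[OF oG qG'])
    then have "real n - C \<le> \<bar>of_int v\<bar> + int_hlen h" "\<bar>of_int v\<bar> + int_hlen h \<le> real n + C"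
      using fd[OF one_GZ_in gG[OF \<sigma>, of n]] unfolding o q' rho1_central[OF \<sigma>] by auto
    with hB have "real n - C - B \<le> \<bar>of_int v\<bar>" "\<bar>of_int v\<bar> \<le> real n + C" by linarith+
    with vh q' hB show ?thesis by blast
  qed
  \<comment> \<open>If \<open>v\<close> and \<open>v'\<close> have the same sign, then
    \<open>Q \<le> 3 * C + 3 * B\<close>; otherwise
    \<open>2 * real n \<le> Q + 3 * C + 2 * B\<close>. \<open>K\<close> exceeds both
    constants.\<close>
  define K where "K = 3 * C + 4 * B + 10"
  have K: "10 \<le> K" using C A by (simp add: K_def B_def)
  obtain n :: nat where n: "real n > (K + 10)\<^sup>2" using reals_Archimedean2 by blast
  obtain v h where v: "(v, h) \<in> carrier GZ" "f (?g n 1) = (w + v, b \<odot> h)" "int_hlen h \<le> B"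
      "real n - C - B \<le> \<bar>of_int v\<bar>" "\<bar>of_int v\<bar> \<le> real n + C"
    using image[of 1 n] by auto
  obtain v' h' where v': "(v', h') \<in> carrier GZ" "f (?g n (- 1)) = (w + v', b \<odot> h')" "int_hlen h' \<le> B"
      "real n - C - B \<le> \<bar>of_int v'\<bar>" "\<bar>of_int v'\<bar> \<le> real n + C"
    using image[of "- 1" n] by auto
  have G: "(w + v, b \<odot> h) \<in> carrier GZ" "(w + v', b \<odot> h') \<in> carrier GZ"
    using fG[OF gG[of 1 n]] fG[OF gG[of "- 1" n]] v(2) v'(2) by simp_all
  define R where "R = rho2 (f (?g n 1)) (f (?g n (- 1)))"
  define Q where "Q = rho1 (?g n 1) (?g n (- 1))"
  have QR: "Q - C \<le> R" "R \<le> Q + C" using fd[OF gG[of 1 n] gG[of "- 1" n]] by (auto simp: Q_def R_def)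
  have mh: "(- v, - h) \<in> carrier GZ" using GZ.inv_closed[OF v(1)] by (simp add: inv_GZ_minus[OF v(1)])
  have "- (b \<odot> h) \<odot> (b \<odot> h') = - h \<odot> h'" by (simp add: minus_hmult hmult_assoc)
  then have R: "R = \<bar>of_int (v' - v)\<bar> + int_hlen (- h \<odot> h')"
    unfolding R_def v(2) v'(2) rho2_eq[OF G] by simp
  have R2: "int_hlen (- h \<odot> h') \<le> 2 * B"
    using int_hlen_hmult[OF mh v'(1)] int_hlen_minus[OF v(1)] v(3) v'(3) by linarith
  have "Q = real (word_length GZ S1 (0, 0, 0, - 2 * real n))"
    unfolding Q_def using word_metric_GZ[OF gG[of 1 n] gG[of "- 1" n]] by simp
  moreover have G2: "(0, 0, 0, - 2 * real n) \<in> carrier GZ" by (intro central_in_GZ) auto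
  ultimately have Q: "Q = real (word_length GZ S1 (0, 0, 0, - 2 * real n))" by simp
  obtain c where c: "c \<le> 8 * sqrt \<bar>- 2 * real n\<bar> + 2" "hpath \<int> c (0, 0, - 2 * real n)"
    using hpath_Ints_central[of "- 2 * real n"] by auto
  define r where "r = sqrt (2 * real n)"
  have r2: "r * r = 2 * real n" by (simp add: r_def)
  have Q_le: "Q \<le> 8 * r + 6"
    using word_length_S1_le[OF c(2), of 0] c(1) by (simp add: Q r_def)
  have "(K + 10)\<^sup>2 \<le> 2 * real n" using n by linarith
  then have rK: "K + 10 \<le> r" unfolding r_def by (rule real_le_rsqrt)
  \<comment> \<open>A word of length at most \<open>K\<close> has central coordinate at most
    \<open>K + K\<^sup>2\<close>, which is less than \<open>2 * real n\<close>.\<close>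
  have Q_ge: "K < Q"
  proof (rule ccontr)
    assume "\<not> K < Q"
    obtain d h k m where d: "(0, 0, - 2 * real n) = (0, 0, k) \<odot> h" "hpath \<int> d h" "\<bar>k\<bar> \<le> m" "m + d \<le> Q"
      using word_length_S1_ge[OF G2] unfolding Q by metis
    have h: "h = (0, 0, - 2 * real n - k)" using d(1) by (cases h) auto
    have d0: "0 \<le> d" "\<bar>- 2 * real n - k\<bar> \<le> d\<^sup>2" using hpath_bounds(2)[OF d(2)[unfolded h]] hpath_nonneg[OF d(2)] by auto
    have "d \<le> K" "\<bar>k\<bar> \<le> K" using d d0 \<open>\<not> K < Q\<close> by linarith+
    moreover from this have "d\<^sup>2 \<le> K\<^sup>2" using d0 by (intro power_mono)
    ultimately have "2 * real n \<le> K + K\<^sup>2" using d0 by linarith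
    with n K show False by (simp add: power2_eq_square algebra_simps)
  qed
  have far: "8 * r + 6 + K < 2 * real n"
  proof -
    have "(K + 10) * r \<le> r * r" using rK K by (intro mult_right_mono) auto
    moreover have "K * 10 \<le> K * r" using rK K by (intro mult_left_mono) auto
    ultimately show ?thesis using rK K unfolding r2 distrib_right by linarith
  qed
  show False
  proof (cases "0 \<le> v \<longleftrightarrow> 0 \<le> v'")
    case True
    then have "\<bar>of_int (v' - v)\<bar> = \<bar>\<bar>real_of_int v'\<bar> - \<bar>real_of_int v\<bar>\<bar>" by (cases "0 \<le> v") auto
    then have "\<bar>of_int (v' - v)\<bar> \<le> 2 * C + B" using v(4,5) v'(4,5) by linarith
    then show False using R R2 QR Q_ge A C unfolding K_def B_def by linarith
  next
    case False
    then have "\<bar>of_int (v' - v)\<bar> = \<bar>real_of_int v'\<bar> + \<bar>real_of_int v\<bar>" by (cases "0 \<le> v") auto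
    then have "2 * real n - 2 * C - 2 * B \<le> R" using v(4) v'(4) unfolding R by linarith
    then show False using QR Q_le far A C unfolding K_def B_def by linarith
  qed
qed

section \<open>The asymptotic cone\<close>

definition cone_dist :: "real \<times> real \<times> real \<times> real \<Rightarrow> real \<times> real \<times> real \<times> real \<Rightarrow> real" where
  "cone_dist p q = \<bar>fst q - fst p\<bar> + hlen (- snd p \<odot> snd q)"

lemma Metric_space_cone_dist: "Metric_space UNIV cone_dist"
proof
  show "0 \<le> cone_dist p q" for p q
    using hlen_nonneg by (simp add: cone_dist_def)
  show "cone_dist p q = cone_dist q p" for p q
    using hlen_minus[of "- snd p \<odot> snd q"] by (simp add: cone_dist_def minus_hmult abs_minus_commute)
  show "cone_dist p q = 0 \<longleftrightarrow> p = q" for p q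
  proof
    assume "cone_dist p q = 0"
    then have "fst q = fst p" "- snd p \<odot> snd q = 0"
      using hlen_nonneg[of "- snd p \<odot> snd q"] by (auto simp: cone_dist_def simp flip: hlen_eq_0_iff)
    moreover from this have "snd q = snd p" by (metis hmult_0(1) hmult_minus_cancel(1))
    ultimately show "p = q" by (simp add: prod_eq_iff)
  qed (simp add: cone_dist_def hlen_eq_0_iff)
  show "cone_dist p r \<le> cone_dist p q + cone_dist q r" for p q r
  proof -
    have "- snd p \<odot> snd r = (- snd p \<odot> snd q) \<odot> (- snd q \<odot> snd r)" by (simp only: hmult_assoc hmult_minus_cancel)
    then show ?thesis
      using hlen_hmult[of "- snd p \<odot> snd q" "- snd q \<odot> snd r"] by (simp add: cone_dist_def)
  qed
qed

interpretation cone: Metric_space UNIV cone_dist by (rule Metric_space_cone_dist)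

text \<open>The bound \<open>hlen_upper\<close> is continuous in the coordinates and vanishes at the
  limit, so Euclidean convergence implies convergence in the cone.\<close>

lemma hlen_diff_tendsto:
  assumes "X \<longlonglongrightarrow> l" shows "(\<lambda>n. hlen (- X n \<odot> l)) \<longlonglongrightarrow> 0"
proof -
  obtain a b c where l: "l = (a, b, c)" by (cases l)
  define x y z where "x = (\<lambda>n. fst (X n))" and "y = (\<lambda>n. fst (snd (X n)))" and "z = (\<lambda>n. snd (snd (X n)))"
  have xyz: "X n = (x n, y n, z n)" for n by (simp add: x_def y_def z_def)
  have lim: "x \<longlonglongrightarrow> a" "y \<longlonglongrightarrow> b" "z \<longlonglongrightarrow> c"
    using tendsto_fst[OF assms] tendsto_fst[OF tendsto_snd[OF assms]] tendsto_snd[OF tendsto_snd[OF assms]]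
    by (auto simp: x_def y_def z_def l)
  define u where "u = (\<lambda>n. \<bar>a - x n\<bar> + \<bar>b - y n\<bar> + 4 * sqrt \<bar>c - z n + (y n * a - x n * b) / 2 - (a - x n) * (b - y n) / 2\<bar>)"
  have "u \<longlonglongrightarrow> \<bar>a - a\<bar> + \<bar>b - b\<bar> + 4 * sqrt \<bar>c - c + (b * a - a * b) / 2 - (a - a) * (b - b) / 2\<bar>"
    unfolding u_def by (intro tendsto_intros lim) auto
  then have u: "u \<longlonglongrightarrow> 0" by simp
  have "hlen (- X n \<odot> l) \<le> u n" for n
  proof -
    have "- X n \<odot> l = (a - x n, b - y n, c - z n + (y n * a - x n * b) / 2)"
      by (simp add: xyz l)
    then show ?thesis using hlen_upper by (simp add: u_def)
  qed
  then show ?thesis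
    by (intro tendsto_sandwich[OF _ _ tendsto_const u]) (auto simp: hlen_nonneg)
qed

lemma proper_cone_dist: "proper_metric_space UNIV cone_dist"
proof -
  have "compactin cone.mtopology (cone.mcball x r)" for x r
    unfolding cone.compactin_sequentially
  proof (intro conjI allI impI)
    fix \<sigma> :: "nat \<Rightarrow> real \<times> real \<times> real \<times> real"
    assume ran: "range \<sigma> \<subseteq> cone.mcball x r"
    have \<sigma>: "cone_dist x (\<sigma> n) \<le> r" for n using subsetD[OF ran rangeI[of \<sigma> n]] by simp
    \<comment> \<open>Translating the centre of the ball to the identity lets
      \<open>hlen_bounds\<close> place the sequence in a compact Euclidean box.\<close>
    define \<tau> where "\<tau> = (\<lambda>n. (fst (\<sigma> n) - fst x, - snd x \<odot> snd (\<sigma> n)))"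
    let ?K = "{- r..r} \<times> {- r..r} \<times> {- r..r} \<times> {- (r\<^sup>2)..r\<^sup>2}"
    have "\<tau> n \<in> ?K" for n
    proof -
      obtain a b c where abc: "- snd x \<odot> snd (\<sigma> n) = (a, b, c)" by (cases "- snd x \<odot> snd (\<sigma> n)")
      have le: "\<bar>fst (\<sigma> n) - fst x\<bar> + hlen (a, b, c) \<le> r"
        using \<sigma>[of n] by (simp add: cone_dist_def abc)
      then have "sqrt \<bar>c\<bar> \<le> r" "\<bar>a\<bar> + \<bar>b\<bar> \<le> r" "\<bar>fst (\<sigma> n) - fst x\<bar> \<le> r"
        using hlen_bounds(1)[of a b c] hlen_bounds(2)[of c a b] hlen_nonneg[of "(a, b, c)"]
          abs_ge_zero[of "fst (\<sigma> n) - fst x"] by linarith+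
      moreover from this have "\<bar>c\<bar> \<le> r\<^sup>2" by (simp add: sqrt_le_D)
      ultimately show ?thesis by (auto simp: \<tau>_def abc abs_le_iff)
    qed
    moreover have "compact ?K" by (intro compact_Times compact_Icc)
    ultimately obtain l k where k: "strict_mono k" "(\<tau> \<circ> k) \<longlonglongrightarrow> l"
      using seq_compactE[of ?K \<tau>] unfolding compact_eq_seq_compact_metric by metis
    define L where "L = (fst x + fst l, snd x \<odot> snd l)"
    have "cone_dist (\<sigma> n) L = \<bar>fst l - fst (\<tau> n)\<bar> + hlen (- snd (\<tau> n) \<odot> snd l)" for n
      by (simp add: cone_dist_def L_def \<tau>_def minus_hmult hmult_assoc algebra_simps)
    moreover have "(\<lambda>n. \<bar>fst l - fst (\<tau> (k n))\<bar> + hlen (- snd (\<tau> (k n)) \<odot> snd l)) \<longlonglongrightarrow> \<bar>fst l - fst l\<bar> + 0"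
      by (intro tendsto_intros hlen_diff_tendsto k(2)[unfolded o_def])
    ultimately have lim: "(\<lambda>n. cone_dist (\<sigma> (k n)) L) \<longlonglongrightarrow> 0" by simp
    have "cone_dist x L \<le> r"
    proof (rule LIMSEQ_le_const)
      show "(\<lambda>n. r + cone_dist (\<sigma> (k n)) L) \<longlonglongrightarrow> r" using tendsto_add[OF tendsto_const lim] by simp
      show "\<exists>N. \<forall>n\<ge>N. cone_dist x L \<le> r + cone_dist (\<sigma> (k n)) L"
      proof (intro exI allI impI)
        fix n
        show "cone_dist x L \<le> r + cone_dist (\<sigma> (k n)) L"
          using cone.triangle[of x "\<sigma> (k n)" L] \<sigma>[of "k n"] by simp
      qed
    qed
    moreover have "limitin cone.mtopology (\<sigma> \<circ> k) L sequentially"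
      using lim by (simp add: cone.limitin_metric_dist_null)
    ultimately show "\<exists>l r'. l \<in> cone.mcball x r \<and> strict_mono r' \<and> limitin cone.mtopology (\<sigma> \<circ> r') l sequentially"
      using k(1) by (intro exI[of _ L] exI[of _ k]) simp
  qed simp
  then show ?thesis by (simp add: proper_metric_space_def Metric_space_cone_dist)
qed

definition cone_scale :: "real \<Rightarrow> real \<times> real \<times> real \<times> real \<Rightarrow> real \<times> real \<times> real \<times> real" where
  "cone_scale t p = (t * fst p, dilate t (snd p))"

lemma cone_dist_scale:
  assumes "0 < t" shows "cone_dist (cone_scale t p) (cone_scale t q) = t * cone_dist p q"
proof -
  have "cone_dist (cone_scale t p) (cone_scale t q) =
      \<bar>t * (fst q - fst p)\<bar> + hlen (dilate t (- snd p \<odot> snd q))"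
    by (simp add: cone_dist_def cone_scale_def dilate_hmult dilate_minus right_diff_distrib)
  then show ?thesis using assms by (simp add: cone_dist_def hlen_dilate abs_mult distrib_left)
qed

lemma cone_scale_inverse: "0 < t \<Longrightarrow> cone_scale t (cone_scale (1 / t) p) = p"
  by (simp add: cone_scale_def dilate_dilate dilate_1)

lemma cone_scale_0: "cone_scale t 0 = 0"
  by (simp add: cone_scale_def dilate_def zero_prod_def)

section \<open>Comparing the word metrics with the cone metric\<close>

definition GZ_embed :: "int \<times> real \<times> real \<times> real \<Rightarrow> real \<times> real \<times> real \<times> real" where
  "GZ_embed = (\<lambda>(v, g). (of_int v, g))"

lemma GZ_embed_0: "GZ_embed (0, 0, 0, 0) = 0"
  by (simp add: GZ_embed_def zero_prod_def)

lemma cone_dist_embed: "cone_dist (GZ_embed (v, g)) (GZ_embed (w, h)) = \<bar>of_int (w - v)\<bar> + hlen (- g \<odot> h)"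
  by (simp add: cone_dist_def GZ_embed_def)

text \<open>Rounding costs 1 in each of the first three coordinates and 4 for the root of a central
  error of at most 1.\<close>

lemma GZ_embed_dense:
  obtains a where "a \<in> carrier GZ" "cone_dist p (GZ_embed a) \<le> 7"
proof -
  obtain s x y z where p: "p = (s, x, y, z)" by (cases p)
  define a b :: int where "a = \<lfloor>x\<rfloor>" and "b = \<lfloor>y\<rfloor>"
  \<comment> \<open>\<open>t\<close> is the central coordinate at which the area term of
    \<open>hlen_upper\<close> vanishes; \<open>c\<close> rounds it up within
    \<open>a * b / 2 + \<int>\<close>, the coset allowed by the lattice.\<close>
  define t where "t = z - (y * a - x * b) / 2 + (a - x) * (b - y) / 2"
  define c where "c = real_of_int a * real_of_int b / 2 + of_int \<lceil>t - real_of_int a * real_of_int b / 2\<rceil>"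
  have "c - real_of_int a * real_of_int b / 2 \<in> \<int>" by (simp add: c_def)
  then obtain e where "hpath \<int> e (of_int a, of_int b, c)"
    using hpath_Ints_exists[OF Ints_of_int Ints_of_int] by blast
  then have G: "(\<lfloor>s\<rfloor>, of_int a, of_int b, c) \<in> carrier GZ" by (auto simp: mem_carrier_GZ)
  have "\<bar>c - t\<bar> \<le> 1" unfolding c_def by linarith
  then have sq: "sqrt \<bar>c - t\<bar> \<le> 1" by simp
  have ab: "\<bar>of_int a - x\<bar> \<le> 1" "\<bar>of_int b - y\<bar> \<le> 1" "\<bar>of_int \<lfloor>s\<rfloor> - s\<bar> \<le> 1" unfolding a_def b_def by linarith+
  have "- (x, y, z) \<odot> (of_int a, of_int b, c) = (a - x, b - y, c - z + (y * a - x * b) / 2)" by simp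
  moreover have "c - z + (y * a - x * b) / 2 - (a - x) * (b - y) / 2 = c - t" by (simp add: t_def)
  ultimately have "hlen (- (x, y, z) \<odot> (of_int a, of_int b, c)) \<le> \<bar>of_int a - x\<bar> + \<bar>of_int b - y\<bar> + 4 * sqrt \<bar>c - t\<bar>"
    using hlen_upper[of "a - x" "b - y" "c - z + (y * a - x * b) / 2"] by metis
  moreover have "cone_dist p (GZ_embed (\<lfloor>s\<rfloor>, of_int a, of_int b, c)) =
      \<bar>of_int \<lfloor>s\<rfloor> - s\<bar> + hlen (- (x, y, z) \<odot> (of_int a, of_int b, c))"
    by (simp add: cone_dist_def GZ_embed_def p)
  ultimately have "cone_dist p (GZ_embed (\<lfloor>s\<rfloor>, of_int a, of_int b, c)) \<le> 7"
    using ab sq by linarith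
  with G show ?thesis by (rule that)
qed

text \<open>\<open>K\<close> may grow as \<open>\<epsilon>\<close> shrinks. Rescaling by
  \<open>n\<close> kills \<open>K\<close>, which yields the cone; one fixed
  \<open>\<epsilon> < 1\<close> already yields a quasi-isometry.\<close>

definition asymptotic_to_cone :: "(int \<times> real \<times> real \<times> real \<Rightarrow> int \<times> real \<times> real \<times> real \<Rightarrow> real) \<Rightarrow> bool" where
  "asymptotic_to_cone \<rho> \<longleftrightarrow> (\<forall>\<epsilon>>0. \<exists>K\<ge>0. \<forall>a\<in>carrier GZ. \<forall>b\<in>carrier GZ.
     \<bar>\<rho> a b - cone_dist (GZ_embed a) (GZ_embed b)\<bar> \<le> \<epsilon> * cone_dist (GZ_embed a) (GZ_embed b) + K)"

lemma asymptotic_to_coneD: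
  assumes "asymptotic_to_cone \<rho>" "0 < \<epsilon>"
  obtains K where "0 \<le> K" "\<forall>a\<in>carrier GZ. \<forall>b\<in>carrier GZ.
    \<bar>\<rho> a b - cone_dist (GZ_embed a) (GZ_embed b)\<bar> \<le> \<epsilon> * cone_dist (GZ_embed a) (GZ_embed b) + K"
  using assms unfolding asymptotic_to_cone_def by blast

lemma asymptotic_coneI:
  assumes "asymptotic_to_cone \<rho>"
  shows "asymptotic_cone (carrier GZ) \<rho> \<one>\<^bsub>GZ\<^esub> UNIV cone_dist 0"
proof -
  let ?e = "(0, 0, 0, 0) :: int \<times> real \<times> real \<times> real"
  let ?D = "\<lambda>a b. cone_dist (GZ_embed a) (GZ_embed b)"
  have "\<forall>\<^sub>F n in sequentially. \<exists>f. f \<in> {a \<in> carrier GZ. \<rho> ?e a / real n < r} \<rightarrow> UNIV \<and> f ?e = 0 \<and>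
      (\<forall>a\<in>{a \<in> carrier GZ. \<rho> ?e a / real n < r}. \<forall>b\<in>{a \<in> carrier GZ. \<rho> ?e a / real n < r}.
         \<bar>cone_dist (f a) (f b) - \<rho> a b / real n\<bar> < \<epsilon>) \<and>
      (\<forall>y\<in>{y \<in> UNIV. cone_dist 0 y < r - \<epsilon>}. \<exists>a\<in>{a \<in> carrier GZ. \<rho> ?e a / real n < r}. cone_dist y (f a) < \<epsilon>)"
    if r: "0 < r" and \<epsilon>: "0 < \<epsilon>" for r \<epsilon> :: real
  proof -
    \<comment> \<open>\<open>\<delta> \<le> 1 / 2\<close> puts the ball of \<open>\<rho>\<close>
      into a ball of \<open>?D\<close> with about twice the radius;
      \<open>\<epsilon> / (16 * r)\<close> then keeps the relative error there below
      \<open>\<epsilon> * real n / 4\<close>, up to a multiple of \<open>K\<close>.\<close>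
    define \<delta> where "\<delta> = min (1 / 2) (\<epsilon> / (16 * r))"
    have \<delta>: "0 < \<delta>" "\<delta> \<le> 1 / 2" "\<delta> * r \<le> \<epsilon> / 16"
    proof -
      show "0 < \<delta>" "\<delta> \<le> 1 / 2" using r \<epsilon> by (auto simp: \<delta>_def)
      have "\<delta> * r \<le> \<epsilon> / (16 * r) * r" using r by (intro mult_right_mono) (auto simp: \<delta>_def)
      then show "\<delta> * r \<le> \<epsilon> / 16" using r by simp
    qed
    obtain K where K: "0 \<le> K" "\<forall>a\<in>carrier GZ. \<forall>b\<in>carrier GZ. \<bar>\<rho> a b - ?D a b\<bar> \<le> \<delta> * ?D a b + K"
      by (rule asymptotic_to_coneD[OF assms \<delta>(1)])
    obtain N :: nat where N: "(40 + 10 * K) / \<epsilon> < real N" using reals_Archimedean2 by blast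
    show ?thesis
      unfolding eventually_sequentially
    proof (rule exI[of _ N], intro allI impI)
      fix n assume "N \<le> n"
      then have "(40 + 10 * K) / \<epsilon> < real n" using N by linarith
      then have n\<epsilon>: "40 + 10 * K < \<epsilon> * real n" using \<epsilon> by (simp add: field_simps)
      then have n: "0 < real n" using \<epsilon> K(1) by (cases n) auto
      let ?f = "\<lambda>a. cone_scale (1 / real n) (GZ_embed a)"
      have f: "cone_dist (?f a) (?f b) = ?D a b / real n" for a b
        using cone_dist_scale[of "1 / real n"] n by simp
      have \<delta>rn: "\<delta> * (r * real n) \<le> \<epsilon> * real n / 16"
        using mult_right_mono[OF \<delta>(3), of "real n"] n by (simp add: mult.assoc)
      show "\<exists>f. f \<in> {a \<in> carrier GZ. \<rho> ?e a / real n < r} \<rightarrow> UNIV \<and> f ?e = 0 \<and>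
        (\<forall>a\<in>{a \<in> carrier GZ. \<rho> ?e a / real n < r}. \<forall>b\<in>{a \<in> carrier GZ. \<rho> ?e a / real n < r}.
          \<bar>cone_dist (f a) (f b) - \<rho> a b / real n\<bar> < \<epsilon>) \<and>
        (\<forall>y\<in>{y \<in> UNIV. cone_dist 0 y < r - \<epsilon>}. \<exists>a\<in>{a \<in> carrier GZ. \<rho> ?e a / real n < r}. cone_dist y (f a) < \<epsilon>)"
      proof (intro exI[of _ ?f] conjI ballI)
        show "?f ?e = 0" by (simp add: GZ_embed_0 cone_scale_0)
      next
        fix a b
        assume "a \<in> {a \<in> carrier GZ. \<rho> ?e a / real n < r}" "b \<in> {a \<in> carrier GZ. \<rho> ?e a / real n < r}"
        then have ab: "a \<in> carrier GZ" "\<rho> ?e a < r * real n" "b \<in> carrier GZ" "\<rho> ?e b < r * real n"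
          using n by (auto simp: field_simps)
        have half: "?D ?e a \<le> 2 * (r * real n) + 2 * K" if "a \<in> carrier GZ" "\<rho> ?e a < r * real n" for a
        proof -
          have "\<delta> * ?D ?e a \<le> 1 / 2 * ?D ?e a" using \<delta>(2) by (intro mult_right_mono cone.nonneg)
          then show ?thesis using K(2)[rule_format, OF one_GZ_in that(1)] that(2) by linarith
        qed
        have "?D a b \<le> 4 * (r * real n) + 4 * K"
          using cone.triangle[of "GZ_embed a" "GZ_embed ?e" "GZ_embed b"] cone.commute[of "GZ_embed a" "GZ_embed ?e"]
            half[OF ab(1,2)] half[OF ab(3,4)] by simp
        then have "\<delta> * ?D a b \<le> \<delta> * (4 * (r * real n) + 4 * K)" using \<delta>(1) by (intro mult_left_mono) auto
        also have "\<dots> = 4 * (\<delta> * (r * real n)) + 4 * (\<delta> * K)" by (simp add: algebra_simps)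
        also have "\<delta> * K \<le> 1 / 2 * K" using \<delta>(2) K(1) by (intro mult_right_mono)
        finally have "\<bar>\<rho> a b - ?D a b\<bar> < \<epsilon> * real n"
          using K(2)[rule_format, OF ab(1,3)] \<delta>rn n\<epsilon> K(1) by linarith
        moreover have "\<bar>?D a b / real n - \<rho> a b / real n\<bar> = \<bar>\<rho> a b - ?D a b\<bar> / real n"
          using n by (simp add: abs_minus_commute flip: diff_divide_distrib)
        ultimately show "\<bar>cone_dist (?f a) (?f b) - \<rho> a b / real n\<bar> < \<epsilon>"
          unfolding f using n by (simp add: divide_less_eq)
      next
        fix y assume "y \<in> {y \<in> UNIV. cone_dist 0 y < r - \<epsilon>}"
        then have y: "cone_dist 0 y < r - \<epsilon>" by simp
        \<comment> \<open>Round the dilated point to the lattice; the margin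
          \<open>\<epsilon>\<close> in the radius keeps the result inside the ball of
          \<open>\<rho>\<close>.\<close>
        obtain a where a: "a \<in> carrier GZ" "cone_dist (cone_scale (real n) y) (GZ_embed a) \<le> 7"
          using GZ_embed_dense .
        have "cone_dist 0 (cone_scale (real n) y) = real n * cone_dist 0 y"
          using cone_dist_scale[OF n, of 0 y] by (simp add: cone_scale_0)
        also have "\<dots> \<le> real n * (r - \<epsilon>)" using y n by (intro mult_left_mono) auto
        finally have Da: "?D ?e a \<le> r * real n - \<epsilon> * real n + 7"
          using cone.triangle[of 0 "cone_scale (real n) y" "GZ_embed a"] a(2) by (simp add: GZ_embed_0 algebra_simps)
        have "?D ?e a \<le> r * real n + 7" using Da n\<epsilon> K(1) by linarith
        then have "\<delta> * ?D ?e a \<le> \<delta> * (r * real n + 7)" using \<delta>(1) by (intro mult_left_mono) auto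
        then have "\<delta> * ?D ?e a \<le> \<epsilon> * real n / 16 + 7 / 2" using \<delta>rn \<delta>(2) unfolding distrib_left by linarith
        then have "\<rho> ?e a < r * real n" using K(2)[rule_format, OF one_GZ_in a(1)] Da n\<epsilon> K(1) by linarith
        then have "\<rho> ?e a / real n < r" using n by (simp add: divide_less_eq)
        moreover have "cone_dist y (?f a) < \<epsilon>"
        proof -
          have "real n * cone_dist y (?f a) = cone_dist (cone_scale (real n) y) (GZ_embed a)"
            by (simp only: cone_dist_scale[OF n, symmetric] cone_scale_inverse[OF n])
          then have "real n * cone_dist y (?f a) < real n * \<epsilon>" using a(2) n\<epsilon> K(1) by (simp add: mult.commute)
          then show ?thesis using n by simp
        qed
        ultimately show "\<exists>a\<in>{a \<in> carrier GZ. \<rho> ?e a / real n < r}. cone_dist y (?f a) < \<epsilon>" using a(1) by blast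
      qed auto
    qed
  qed
  then show ?thesis
    unfolding asymptotic_cone_def pointed_GH_converges_def one_GZ
    by (intro conjI proper_cone_dist allI impI) auto
qed

lemma asymptotic_to_coneI:
  assumes "\<And>\<epsilon>. 0 < \<epsilon> \<Longrightarrow> \<exists>K\<ge>0. \<forall>v g. (v, g) \<in> carrier GZ \<longrightarrow>
    \<bar>real (word_length GZ S (v, g)) - (\<bar>of_int v\<bar> + hlen g)\<bar> \<le> \<epsilon> * (\<bar>of_int v\<bar> + hlen g) + K"
  shows "asymptotic_to_cone (word_metric GZ S)"
  unfolding asymptotic_to_cone_def
proof (intro allI impI)
  fix \<epsilon> :: real assume "0 < \<epsilon>"
  from assms[OF this] obtain K where K: "0 \<le> K" "\<And>v g. (v, g) \<in> carrier GZ \<Longrightarrow>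
    \<bar>real (word_length GZ S (v, g)) - (\<bar>of_int v\<bar> + hlen g)\<bar> \<le> \<epsilon> * (\<bar>of_int v\<bar> + hlen g) + K" by blast
  have "\<bar>word_metric GZ S a b - cone_dist (GZ_embed a) (GZ_embed b)\<bar> \<le> \<epsilon> * cone_dist (GZ_embed a) (GZ_embed b) + K"
    if "a \<in> carrier GZ" "b \<in> carrier GZ" for a b
  proof -
    obtain v g where a: "a = (v, g)" by (rule prod.exhaust)
    obtain w h where b: "b = (w, h)" by (rule prod.exhaust)
    show ?thesis
      unfolding a b cone_dist_embed word_metric_GZ[OF that[unfolded a b]]
      by (rule K(2)[OF GZ_diff_closed[OF that[unfolded a b]]])
  qed
  with K(1) show "\<exists>K\<ge>0. \<forall>a\<in>carrier GZ. \<forall>b\<in>carrier GZ.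
     \<bar>word_metric GZ S a b - cone_dist (GZ_embed a) (GZ_embed b)\<bar> \<le> \<epsilon> * cone_dist (GZ_embed a) (GZ_embed b) + K"
    by blast
qed

lemma hpath_Ints_hlen:
  assumes "0 < \<epsilon>"
  obtains K where "0 \<le> K" "\<And>v g. (v, g) \<in> carrier GZ \<Longrightarrow> \<exists>c. hpath \<int> c g \<and> c \<le> (1 + \<epsilon>) * hlen g + K"
proof -
  obtain K where K: "0 \<le> K" "\<And>c e g. hpath UNIV c g \<Longrightarrow> hpath \<int> e g \<Longrightarrow> \<exists>c'. hpath \<int> c' g \<and> c' \<le> (1 + \<epsilon>) * c + K"
    using hpath_Ints_approx[OF assms] by blast
  show ?thesis
  \<comment> \<open>The infimum \<open>hlen g\<close> is approached within 1, which adds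
    \<open>1 + \<epsilon>\<close>.\<close>
  proof (rule that[of "1 + \<epsilon> + K"])
    show "0 \<le> 1 + \<epsilon> + K" using assms K(1) by simp
    fix v g assume "(v, g) \<in> carrier GZ"
    then obtain e where e: "hpath \<int> e g" by (auto simp: mem_carrier_GZ)
    obtain c where c: "c < hlen g + 1" "hpath UNIV c g" using hlen_lessD[of g "hlen g + 1"] by auto
    obtain c' where c': "hpath \<int> c' g" "c' \<le> (1 + \<epsilon>) * c + K" using K(2)[OF c(2) e] by blast
    have "(1 + \<epsilon>) * c \<le> (1 + \<epsilon>) * (hlen g + 1)" using c(1) assms by (intro mult_left_mono) auto
    then have "c' \<le> (1 + \<epsilon>) * hlen g + (1 + \<epsilon> + K)" using c'(2) by (simp add: algebra_simps)
    with c'(1) show "\<exists>c. hpath \<int> c g \<and> c \<le> (1 + \<epsilon>) * hlen g + (1 + \<epsilon> + K)" by blast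
  qed
qed

text \<open>Integral paths are real paths, so one inequality holds without error; the other is the
  rounding estimate.\<close>

lemma asymptotic_to_cone_rho2: "asymptotic_to_cone rho2"
proof (rule asymptotic_to_coneI)
  fix \<epsilon> :: real assume \<epsilon>: "0 < \<epsilon>"
  obtain K where K: "0 \<le> K" "\<And>v g. (v, g) \<in> carrier GZ \<Longrightarrow> \<exists>c. hpath \<int> c g \<and> c \<le> (1 + \<epsilon>) * hlen g + K"
    using hpath_Ints_hlen[OF \<epsilon>] by blast
  have "\<bar>real (word_length GZ S2 (v, g)) - (\<bar>of_int v\<bar> + hlen g)\<bar> \<le> \<epsilon> * (\<bar>of_int v\<bar> + hlen g) + K"
    if mem: "(v, g) \<in> carrier GZ" for v g
  proof -
    obtain c where c: "hpath \<int> c g" "\<bar>of_int v\<bar> + c \<le> real (word_length GZ S2 (v, g))"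
      using word_length_S2_ge[OF mem] .
    have 1: "\<bar>of_int v\<bar> + hlen g \<le> real (word_length GZ S2 (v, g))"
      using hlen_le[OF hpath_Ints_UNIV[OF c(1)]] c(2) by linarith
    obtain d where d: "hpath \<int> d g" "d \<le> (1 + \<epsilon>) * hlen g + K" using K(2)[OF mem] by blast
    have "0 \<le> \<epsilon> * \<bar>of_int v\<bar>" using \<epsilon> by simp
    with word_length_S2_le[OF d(1), of v] d(2)
    have "real (word_length GZ S2 (v, g)) \<le> \<bar>of_int v\<bar> + hlen g + (\<epsilon> * (\<bar>of_int v\<bar> + hlen g) + K)"
      unfolding distrib_left distrib_right mult_1 by linarith
    with 1 show ?thesis by linarith
  qed
  with K(1) show "\<exists>K\<ge>0. \<forall>v g. (v, g) \<in> carrier GZ \<longrightarrow>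
    \<bar>real (word_length GZ S2 (v, g)) - (\<bar>of_int v\<bar> + hlen g)\<bar> \<le> \<epsilon> * (\<bar>of_int v\<bar> + hlen g) + K" by blast
qed

text \<open>Completing the square turns a square-root error into a small relative one plus a
  constant.\<close>

lemma four_sqrt_le:
  assumes "0 < \<epsilon>" "0 \<le> (l::real)" shows "4 * sqrt l \<le> \<epsilon> * l + 4 / \<epsilon>"
proof -
  have "0 \<le> (\<epsilon> * sqrt l - 2)\<^sup>2" by simp
  also have "\<dots> = \<epsilon> * (\<epsilon> * l + 4 / \<epsilon> - 4 * sqrt l)"
    using assms by (simp add: power2_diff power_mult_distrib algebra_simps power2_eq_square[of \<epsilon>])
  finally show ?thesis using assms(1) by (simp add: zero_le_mult_iff)
qed

lemma asymptotic_to_cone_rho1: "asymptotic_to_cone rho1"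
proof (rule asymptotic_to_coneI)
  fix \<epsilon> :: real assume \<epsilon>: "0 < \<epsilon>"
  obtain K where K: "0 \<le> K" "\<And>v g. (v, g) \<in> carrier GZ \<Longrightarrow> \<exists>c. hpath \<int> c g \<and> c \<le> (1 + \<epsilon>) * hlen g + K"
    using hpath_Ints_hlen[OF \<epsilon>] by blast
  have "\<bar>real (word_length GZ S1 (v, g)) - (\<bar>of_int v\<bar> + hlen g)\<bar> \<le> \<epsilon> * (\<bar>of_int v\<bar> + hlen g) + (K + 4 + 4 / \<epsilon>)"
    if mem: "(v, g) \<in> carrier GZ" for v g
  proof -
    let ?l = "real (word_length GZ S1 (v, g))"
    obtain c h k m where c: "g = (0, 0, k) \<odot> h" "hpath \<int> c h" "\<bar>k\<bar> \<le> m" "\<bar>of_int v\<bar> \<le> m" "m + c \<le> ?l"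
      using word_length_S1_ge[OF mem] .
    \<comment> \<open>The central parts of the letters add up to at most the word length but enter
      \<open>hlen\<close> only through a square root.\<close>
    have "hlen (0, 0, k) \<le> 4 * sqrt \<bar>k\<bar>" using hlen_upper[of 0 0 k] by simp
    moreover have "sqrt \<bar>k\<bar> \<le> sqrt ?l" using c(3,5) hpath_nonneg[OF c(2)] by simp
    moreover have "hlen g \<le> hlen (0, 0, k) + c"
      using hlen_hmult[of "(0, 0, k)" h] hlen_le[OF hpath_Ints_UNIV[OF c(2)]] unfolding c(1) by linarith
    ultimately have "\<bar>of_int v\<bar> + hlen g \<le> ?l + 4 * sqrt ?l" using c(4,5) by linarith
    then have 1: "\<bar>of_int v\<bar> + hlen g \<le> ?l + (\<epsilon> * ?l + 4 / \<epsilon>)" using four_sqrt_le[OF \<epsilon>, of ?l] by simp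
    have nonneg: "0 \<le> \<bar>of_int v\<bar> + hlen g" using hlen_nonneg[of g] by simp
    \<comment> \<open>The error in \<open>1\<close> is relative to the word length. If that is below
      the cone distance, it may be replaced by the latter; otherwise the claim is trivial.\<close>
    have 2: "\<bar>of_int v\<bar> + hlen g \<le> ?l + (\<epsilon> * (\<bar>of_int v\<bar> + hlen g) + 4 / \<epsilon>)"
    proof (cases "\<bar>of_int v\<bar> + hlen g \<le> ?l")
      case True
      moreover have "0 \<le> \<epsilon> * (\<bar>of_int v\<bar> + hlen g) + 4 / \<epsilon>" 
        using \<epsilon> by (intro add_nonneg_nonneg[OF mult_nonneg_nonneg[OF _ nonneg]]) auto
      ultimately show ?thesis by linarith
    next
      case False
      then have "\<epsilon> * ?l \<le> \<epsilon> * (\<bar>of_int v\<bar> + hlen g)" using \<epsilon> by (intro mult_left_mono) auto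
      with 1 show ?thesis by linarith
    qed
    obtain d where d: "hpath \<int> d g" "d \<le> (1 + \<epsilon>) * hlen g + K" using K(2)[OF mem] by blast
    have "0 \<le> \<epsilon> * \<bar>of_int v\<bar>" "0 \<le> 4 / \<epsilon>" using \<epsilon> by auto
    with word_length_S1_le[OF d(1), of v] d(2)
    have "?l \<le> \<bar>of_int v\<bar> + hlen g + (\<epsilon> * (\<bar>of_int v\<bar> + hlen g) + (K + 4 + 4 / \<epsilon>))"
      unfolding distrib_left distrib_right mult_1 by linarith
    with 2 K(1) show ?thesis by linarith
  qed
  moreover have "0 \<le> K + 4 + 4 / \<epsilon>" using K(1) \<epsilon> by simp
  ultimately show "\<exists>K\<ge>0. \<forall>v g. (v, g) \<in> carrier GZ \<longrightarrow>
    \<bar>real (word_length GZ S1 (v, g)) - (\<bar>of_int v\<bar> + hlen g)\<bar> \<le> \<epsilon> * (\<bar>of_int v\<bar> + hlen g) + K" by blast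
qed

text \<open>The identity map works: with relative error 1/2, up to constants both metrics lie
  between 1/2 and 3/2 of the cone metric, whence the factor 3.\<close>

lemma quasi_isometric_rho: "quasi_isometric (carrier GZ) rho1 (carrier GZ) rho2"
proof -
  let ?D = "\<lambda>a b. cone_dist (GZ_embed a) (GZ_embed b)"
  have half: "0 < (1 / 2 :: real)" by simp
  obtain K where K: "0 \<le> K" "\<forall>a\<in>carrier GZ. \<forall>b\<in>carrier GZ. \<bar>rho1 a b - ?D a b\<bar> \<le> 1 / 2 * ?D a b + K"
    by (rule asymptotic_to_coneD[OF asymptotic_to_cone_rho1 half])
  obtain K' where K': "0 \<le> K'" "\<forall>a\<in>carrier GZ. \<forall>b\<in>carrier GZ. \<bar>rho2 a b - ?D a b\<bar> \<le> 1 / 2 * ?D a b + K'"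
    by (rule asymptotic_to_coneD[OF asymptotic_to_cone_rho2 half])
  have le: "rho1 a b / 3 - (3 * K + 3 * K') \<le> rho2 a b \<and> rho2 a b \<le> 3 * rho1 a b + (3 * K + 3 * K')"
    if "a \<in> carrier GZ" "b \<in> carrier GZ" for a b
    using K(2)[rule_format, OF that] K'(2)[rule_format, OF that] K(1) K'(1) by linarith
  have "quasi_isometry 3 (3 * K + 3 * K') (carrier GZ) rho1 (carrier GZ) rho2 id"
    unfolding quasi_isometry_def
  proof (intro conjI ballI)
    fix y assume y: "y \<in> carrier GZ"
    have "rho2 y (id y) \<le> 3 * K + 3 * K'"
      using Metric_space.mdist_zero[OF Metric_space_rho2 y] K(1) K'(1) by simp
    with y show "\<exists>a\<in>carrier GZ. rho2 y (id a) \<le> 3 * K + 3 * K'" by blast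
  qed (use le in auto)
  moreover have "0 \<le> 3 * K + 3 * K'" using K(1) K'(1) by simp
  ultimately show ?thesis
    unfolding quasi_isometric_def quasi_isometric_with_def by (intro exI[of _ 3] exI[of _ "3 * K + 3 * K'"]) auto
qed

theorem theorem5p1:
  shows "quasi_isometric (carrier GZ) rho1 (carrier GZ) rho2 \<and>
    (\<exists>(M1 :: (real \<times> real \<times> real \<times> real) set) d1 o1
      (M2 :: (real \<times> real \<times> real \<times> real) set) d2 o2.
        asymptotic_cone (carrier GZ) rho1 \<one>\<^bsub>GZ\<^esub> M1 d1 o1 \<and>
        asymptotic_cone (carrier GZ) rho2 \<one>\<^bsub>GZ\<^esub> M2 d2 o2 \<and>
        isometric M1 d1 M2 d2) \<and>
    \<not> (\<exists>C>0. quasi_isometric_with 1 C (carrier GZ) rho1 (carrier GZ) rho2)"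
proof (intro conjI)
  have "isometric UNIV cone_dist UNIV cone_dist"
    unfolding isometric_def by (intro exI[of _ id]) auto
  with asymptotic_coneI[OF asymptotic_to_cone_rho1] asymptotic_coneI[OF asymptotic_to_cone_rho2]
  show "\<exists>(M1 :: (real \<times> real \<times> real \<times> real) set) d1 o1
      (M2 :: (real \<times> real \<times> real \<times> real) set) d2 o2.
        asymptotic_cone (carrier GZ) rho1 \<one>\<^bsub>GZ\<^esub> M1 d1 o1 \<and>
        asymptotic_cone (carrier GZ) rho2 \<one>\<^bsub>GZ\<^esub> M2 d2 o2 \<and>
        isometric M1 d1 M2 d2"
    by blast
qed (use quasi_isometric_rho no_1_C_quasi_isometry in auto)

end
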